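(* Let $\varphi\in L^2(\partial\mathbb{B})$, and let $\Pi\varphi$ be its orthogonal projection onto the subspace $L^2_s$ of slice functions. Then the extension of $\Pi\varphi$ to the interior of the unit ball $\mathbb{B}$ is given, for $0\le r<1$, $I\in\mathbb{S}$, $t\in\mathbb{R}$, by $$\Pi\varphi(re^{It})=\int_{\partial\mathbb{B}}K(re^{It},e^{Js})\,\varphi(e^{Js})\,d\Sigma(e^{Js}),$$ where $$K(re^{It},e^{Js})=\frac12\left[P_r^J(t+s)+P_r^J(t-s)\right]+\frac{IJ}{2}\left[P_r^J(t+s)-P_r^J(t-s)\right].$$
   Context: $\mathbb{H}=\mathbb{R}+\mathbb{R}i+\mathbb{R}j+\mathbb{R}k$ is the algebra of quaternions, $\mathbb{B}=\{q\in\mathbb{H}:|q|<1\}$, and $\mathbb{S}=\{q\in\mathbb{H}:q^2=-1\}$ is the 2-sphere of imaginary units, with $\sigma$ its area measure normalized so that $\sigma(\mathbb{S})=1$. Each point of $\partial\mathbb{B}$ has the form $e^{It}=\cos t+I\sin t$ with $I\in\mathbb{S}$, $t\in\mathbb{R}$. The sphere $\partial\mathbb{B}$ carries the probability measure $\Sigma$ given by $$\int_{\partial\mathbb{B}}g\,d\Sigma=\frac{1}{2\pi}\int_0^{2\pi}\int_{\mathbb{S}}g(e^{It})\,d\sigma(I)\,dt.$$ $L^2=L^2(\partial\mathbb{B})$ is the space of measurable $\varphi:\partial\mathbb{B}\to\mathbb{H}$ with $\int|\varphi|^2d\Sigma<\infty$, a right quaternionic Hilbert space with inner product $\langle f,g\rangle=\int_{\partial\mathbb{B}}\overline{g}\,f\,d\Sigma$.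 A function $f:\partial\mathbb{B}\to\mathbb{H}$ is a slice function if for all $I,J\in\mathbb{S}$ and $t\in\mathbb{R}$, $f(e^{Jt})=\frac12[f(e^{It})+f(e^{-It})]+\frac{JI}{2}[f(e^{-It})-f(e^{It})]$; equivalently, $f(e^{Jt})=a(t)+Jb(t)$ for $\mathbb{H}$-valued functions $a,b$ depending on $t$ alone. $L^2_s$ is the set of elements of $L^2$ that are (represented by) measurable slice functions; it is a closed subspace of $L^2$, and $\Pi:L^2\to L^2_s$ is the orthogonal projection. Extension to the interior: a function $f\in L^2_s$ is extended to $\mathbb{B}$ by $$f(re^{It})=\sum_{n=-\infty}^{+\infty}r^{|n|}e^{Int}\widehat f(n),\qquad \widehat f(n)=\frac1{2\pi}\int_{-\pi}^{\pi}e^{-nIs}f(e^{Is})\,ds,$$ where $\widehat f(n)$ does not depend on $I\in\mathbb{S}$. For $0\le r<1$ and $J\in\mathbb{S}$, $P_r^J(t)=\frac{1-r^2}{|1-re^{Jt}|^2}=\sum_{n\in\mathbb{Z}}r^{|n|}e^{Jnt}$ is the Poisson kernel on the unit circle of $\mathbb{R}+\mathbb{R}J$ (it is real and in fact independent of $J$). *)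

theory Defs
  imports "HOL-Analysis.Analysis"
begin

section \<open>The algebra of quaternions\<close>

datatype quat = Quat (qRe: real) (qI: real) (qJ: real) (qK: real)

lemma quat_eq_iff: "p = q \<longleftrightarrow> qRe p = qRe q \<and> qI p = qI q \<and> qJ p = qJ q \<and> qK p = qK q"
  by (cases p; cases q) auto

lemma quat_eqI: "qRe p = qRe q \<Longrightarrow> qI p = qI q \<Longrightarrow> qJ p = qJ q \<Longrightarrow> qK p = qK q \<Longrightarrow> p = q"
  by (simp add: quat_eq_iff)

instantiation quat :: real_vector
begin

definition zero_quat :: quat where "0 = Quat 0 0 0 0"

definition plus_quat :: "quat \<Rightarrow> quat \<Rightarrow> quat" where
  "p + q = Quat (qRe p + qRe q) (qI p + qI q) (qJ p + qJ q) (qK p + qK q)"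

definition uminus_quat :: "quat \<Rightarrow> quat" where
  "- p = Quat (- qRe p) (- qI p) (- qJ p) (- qK p)"

definition minus_quat :: "quat \<Rightarrow> quat \<Rightarrow> quat" where
  "p - q = Quat (qRe p - qRe q) (qI p - qI q) (qJ p - qJ q) (qK p - qK q)"

definition scaleR_quat :: "real \<Rightarrow> quat \<Rightarrow> quat" where
  "c *\<^sub>R p = Quat (c * qRe p) (c * qI p) (c * qJ p) (c * qK p)"

instance
  by standard
    (auto simp: quat_eq_iff zero_quat_def plus_quat_def uminus_quat_def minus_quat_def
      scaleR_quat_def algebra_simps)

end

lemma quat_add_sel [simp]:
  "qRe (p + q) = qRe p + qRe q" "qI (p + q) = qI p + qI q"
  "qJ (p + q) = qJ p + qJ q" "qK (p + q) = qK p + qK q"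
  by (simp_all add: plus_quat_def)

lemma quat_uminus_sel [simp]:
  "qRe (- p) = - qRe p" "qI (- p) = - qI p" "qJ (- p) = - qJ p" "qK (- p) = - qK p"
  by (simp_all add: uminus_quat_def)

lemma quat_diff_sel [simp]:
  "qRe (p - q) = qRe p - qRe q" "qI (p - q) = qI p - qI q"
  "qJ (p - q) = qJ p - qJ q" "qK (p - q) = qK p - qK q"
  by (simp_all add: minus_quat_def)

lemma quat_zero_sel [simp]: "qRe 0 = 0" "qI 0 = 0" "qJ 0 = 0" "qK 0 = 0"
  by (simp_all add: zero_quat_def)

lemma quat_scaleR_sel [simp]:
  "qRe (c *\<^sub>R p) = c * qRe p" "qI (c *\<^sub>R p) = c * qI p"
  "qJ (c *\<^sub>R p) = c * qJ p" "qK (c *\<^sub>R p) = c * qK p"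
  by (simp_all add: scaleR_quat_def)

instantiation quat :: real_algebra_1
begin

definition one_quat :: quat where "1 = Quat 1 0 0 0"

definition times_quat :: "quat \<Rightarrow> quat \<Rightarrow> quat" where
  "p * q = Quat
     (qRe p * qRe q - qI p * qI q - qJ p * qJ q - qK p * qK q)
     (qRe p * qI q + qI p * qRe q + qJ p * qK q - qK p * qJ q)
     (qRe p * qJ q - qI p * qK q + qJ p * qRe q + qK p * qI q)
     (qRe p * qK q + qI p * qJ q - qJ p * qI q + qK p * qRe q)"

instance
  by standard
    (auto simp: quat_eq_iff one_quat_def times_quat_def algebra_simps)

end

lemma quat_one_sel [simp]: "qRe 1 = 1" "qI 1 = 0" "qJ 1 = 0" "qK 1 = 0"
  by (simp_all add: one_quat_def)

lemma quat_mult_sel: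
  "qRe (p * q) = qRe p * qRe q - qI p * qI q - qJ p * qJ q - qK p * qK q"
  "qI (p * q) = qRe p * qI q + qI p * qRe q + qJ p * qK q - qK p * qJ q"
  "qJ (p * q) = qRe p * qJ q - qI p * qK q + qJ p * qRe q + qK p * qI q"
  "qK (p * q) = qRe p * qK q + qI p * qJ q - qJ p * qI q + qK p * qRe q"
  by (simp_all add: times_quat_def)

lemma quat_of_real_sel [simp]:
  "qRe (of_real c) = c" "qI (of_real c) = 0" "qJ (of_real c) = 0" "qK (of_real c) = 0"
  by (simp_all add: of_real_def)

definition qcnj :: "quat \<Rightarrow> quat" where
  "qcnj q = Quat (qRe q) (- qI q) (- qJ q) (- qK q)"

instantiation quat :: real_inner
begin

definition inner_quat :: "quat \<Rightarrow> quat \<Rightarrow> real" where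
  "p \<bullet> q = qRe p * qRe q + qI p * qI q + qJ p * qJ q + qK p * qK q"

definition norm_quat :: "quat \<Rightarrow> real" where
  "norm p = sqrt ((qRe p)\<^sup>2 + (qI p)\<^sup>2 + (qJ p)\<^sup>2 + (qK p)\<^sup>2)"

definition sgn_quat :: "quat \<Rightarrow> quat" where "sgn p = p /\<^sub>R norm (p :: quat)"

definition dist_quat :: "quat \<Rightarrow> quat \<Rightarrow> real" where "dist p q = norm (p - q :: quat)"

definition uniformity_quat :: "(quat \<times> quat) filter" where
  "uniformity_quat = (INF e\<in>{0 <..}. principal {(x, y). dist x y < e})"

definition open_quat :: "quat set \<Rightarrow> bool" where
  "open_quat U \<longleftrightarrow> (\<forall>x\<in>U. eventually (\<lambda>(x', y). x' = x \<longrightarrow> y \<in> U) uniformity)"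

instance
proof
  fix p q s :: quat and c :: real
  show "p \<bullet> q = q \<bullet> p" "(p + q) \<bullet> s = p \<bullet> s + q \<bullet> s" "(c *\<^sub>R p) \<bullet> q = c * (p \<bullet> q)"
    by (simp_all add: inner_quat_def algebra_simps)
  show "0 \<le> p \<bullet> p" by (simp add: inner_quat_def)
  show "p \<bullet> p = 0 \<longleftrightarrow> p = 0"
    unfolding inner_quat_def quat_eq_iff quat_zero_sel
    by (auto simp: add_nonneg_eq_0_iff)
  show "norm p = sqrt (p \<bullet> p)"
    by (simp add: inner_quat_def norm_quat_def power2_eq_square)
qed (rule sgn_quat_def dist_quat_def uniformity_quat_def open_quat_def)+

end

instantiation quat :: inverse
begin

definition inverse_quat :: "quat \<Rightarrow> quat" where
  "inverse p = qcnj p /\<^sub>R (norm p)\<^sup>2"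

definition divide_quat :: "quat \<Rightarrow> quat \<Rightarrow> quat" where
  "p div q = p * inverse (q :: quat)"

instance ..

end

instance quat :: real_normed_div_algebra
proof
  fix p q :: quat
  have nz: "(norm p)\<^sup>2 = (qRe p)\<^sup>2 + (qI p)\<^sup>2 + (qJ p)\<^sup>2 + (qK p)\<^sup>2"
    by (simp add: norm_quat_def)
  show "p \<noteq> 0 \<Longrightarrow> inverse p * p = 1" and "p \<noteq> 0 \<Longrightarrow> p * inverse p = 1"
  proof -
    assume "p \<noteq> 0"
    then have "(norm p)\<^sup>2 \<noteq> 0" by simp
    moreover have "qcnj p * p = of_real ((norm p)\<^sup>2)" "p * qcnj p = of_real ((norm p)\<^sup>2)"
      unfolding nz
      by (auto simp: quat_eq_iff quat_mult_sel qcnj_def power2_eq_square)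
    ultimately show "inverse p * p = 1" "p * inverse p = 1"
      by (simp_all only: inverse_quat_def mult_scaleR_left mult_scaleR_right)
        (simp_all add: scaleR_conv_of_real flip: of_real_mult del: of_real_power)
  qed
  show "p / q = p * inverse q" by (rule divide_quat_def)
  show "inverse (0 :: quat) = 0" by (simp add: inverse_quat_def)
  show "norm (p * q) = norm p * norm q"
    unfolding norm_quat_def quat_mult_sel real_sqrt_mult [symmetric]
    by (rule arg_cong [where f = sqrt]) (simp add: power2_eq_square algebra_simps)
qed

instantiation quat :: euclidean_space
begin

definition Basis_quat :: "quat set" where
  "Basis = {Quat 1 0 0 0, Quat 0 1 0 0, Quat 0 0 1 0, Quat 0 0 0 1}"

instance
proof
  fix p :: quat
  show "(\<forall>q\<in>Basis. p \<bullet> q = 0) \<longleftrightarrow> p = 0"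
    unfolding Basis_quat_def inner_quat_def quat_eq_iff ball_simps by simp
qed (auto simp: Basis_quat_def inner_quat_def)

end


section \<open>Imaginary units and measures on the spheres\<close>

definition imag_units :: "quat set" where
  "imag_units = {q. q\<^sup>2 = -1}"

text \<open>\<open>qcis I t\<close> is \<open>e\<^sup>I\<^sup>t\<close>.\<close>

definition qcis :: "quat \<Rightarrow> real \<Rightarrow> quat" where
  "qcis I t = of_real (cos t) + I * of_real (sin t)"

text \<open>The area measure on the 2-sphere of imaginary units, in spherical coordinates: the
  area element is \<open>sin \<theta> d\<theta> d\<omega>\<close>, the total area is \<open>4\<pi>\<close>.\<close>

definition sphere_coord :: "real \<times> real \<Rightarrow> quat" where
  "sphere_coord = (\<lambda>(\<theta>, \<omega>). Quat 0 (sin \<theta> * cos \<omega>) (sin \<theta> * sin \<omega>) (cos \<theta>))"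

definition unit_area :: "quat measure" where
  "unit_area =
     distr
       (density (restrict_space lborel ({0..pi} \<times> {0..2 * pi}))
         (\<lambda>(\<theta>, \<omega>). ennreal (sin \<theta> / (4 * pi))))
       (restrict_space borel imag_units)
       sphere_coord"

definition sphere_measure :: "quat measure" where
  "sphere_measure =
     distr
       (uniform_measure lborel {0..2 * pi} \<Otimes>\<^sub>M unit_area)
       (restrict_space borel (sphere 0 1))
       (\<lambda>(t, I). qcis I t)"


section \<open>Square-integrable functions, slice functions and the projection\<close>

text \<open>Elements of \<open>L\<^sup>2\<close> are represented by Borel functions; values off the unit sphere of the
  quaternions are irrelevant, since the space of \<open>sphere_measure\<close> is that sphere.\<close>

definition L2 :: "(quat \<Rightarrow> quat) set" where
  "L2 = {f \<in> borel_measurable sphere_measure. integrable sphere_measure (\<lambda>q. (norm (f q))\<^sup>2)}"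

definition L2_inner :: "(quat \<Rightarrow> quat) \<Rightarrow> (quat \<Rightarrow> quat) \<Rightarrow> quat" where
  "L2_inner f g = (LINT q|sphere_measure. qcnj (g q) * f q)"

definition slice_function :: "(quat \<Rightarrow> quat) \<Rightarrow> bool" where
  "slice_function f \<longleftrightarrow>
     (\<forall>I\<in>imag_units. \<forall>J\<in>imag_units. \<forall>t.
        f (qcis J t) =
          (1/2) *\<^sub>R (f (qcis I t) + f (qcis I (- t)))
          + (1/2) *\<^sub>R (J * I * (f (qcis I (- t)) - f (qcis I t))))"

definition L2_slice :: "(quat \<Rightarrow> quat) set" where
  "L2_slice = {f \<in> L2. slice_function f}"

text \<open>\<open>f\<close> is a slice function representing the orthogonal projection of \<open>\<phi>\<close> onto the subspace
  of slice functions. The projection is only determined up to null sets, hence a relation.\<close>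

definition is_slice_projection :: "(quat \<Rightarrow> quat) \<Rightarrow> (quat \<Rightarrow> quat) \<Rightarrow> bool" where
  "is_slice_projection \<phi> f \<longleftrightarrow>
     f \<in> L2_slice \<and> (\<forall>g\<in>L2_slice. L2_inner (\<lambda>q. \<phi> q - f q) g = 0)"


section \<open>Extension to the unit ball and the kernel\<close>

definition slice_coeff :: "quat \<Rightarrow> (quat \<Rightarrow> quat) \<Rightarrow> int \<Rightarrow> quat" where
  "slice_coeff I f n =
     (1 / (2 * pi)) *\<^sub>R (LINT s:{-pi..pi}|lborel. qcis I (- of_int n * s) * f (qcis I s))"

text \<open>\<open>v\<close> is the value at \<open>p\<close> of the extension of \<open>f\<close>: the series converges to \<open>v\<close> for every
  polar representation of \<open>p\<close> and every imaginary unit \<open>L\<close> used to compute the coefficients.\<close>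

definition has_slice_extension :: "(quat \<Rightarrow> quat) \<Rightarrow> quat \<Rightarrow> quat \<Rightarrow> bool" where
  "has_slice_extension f p v \<longleftrightarrow>
     (\<forall>r I t. \<forall>L\<in>imag_units. 0 \<le> r \<and> r < 1 \<and> I \<in> imag_units \<and> p = r *\<^sub>R qcis I t \<longrightarrow>
        ((\<lambda>n::int. r ^ nat \<bar>n\<bar> *\<^sub>R (qcis I (of_int n * t) * slice_coeff L f n)) has_sum v) UNIV)"

definition poisson_kernel :: "quat \<Rightarrow> real \<Rightarrow> real \<Rightarrow> real" where
  "poisson_kernel J r t = (1 - r\<^sup>2) / (norm (1 - r *\<^sub>R qcis J t))\<^sup>2"

definition slice_kernel_polar :: "real \<Rightarrow> quat \<Rightarrow> real \<Rightarrow> quat \<Rightarrow> real \<Rightarrow> quat" where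
  "slice_kernel_polar r I t J s =
     of_real ((1/2) * (poisson_kernel J r (t + s) + poisson_kernel J r (t - s)))
     + (1/2) *\<^sub>R (I * J * of_real (poisson_kernel J r (t + s) - poisson_kernel J r (t - s)))"

text \<open>The kernel as a function on the product of the unit ball and its boundary;
  \<open>slice_kernel_eq\<close> shows that the polar formula is independent of the representations.\<close>

definition slice_kernel :: "quat \<Rightarrow> quat \<Rightarrow> quat" where
  "slice_kernel p q =
     (THE k. \<forall>r I t J s. 0 \<le> r \<and> r < 1 \<and> I \<in> imag_units \<and> J \<in> imag_units
        \<and> p = r *\<^sub>R qcis I t \<and> q = qcis J s \<longrightarrow> k = slice_kernel_polar r I t J s)"

lemma imag_units_iff:
  "I \<in> imag_units \<longleftrightarrow> qRe I = 0 \<and> (qI I)\<^sup>2 + (qJ I)\<^sup>2 + (qK I)\<^sup>2 = 1"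
proof
  assume "I \<in> imag_units"
  then have "I * I = -1" by (simp add: imag_units_def power2_eq_square)
  then have e: "(qRe I)\<^sup>2 - (qI I)\<^sup>2 - (qJ I)\<^sup>2 - (qK I)\<^sup>2 = -1"
    and z: "qRe I * qI I = 0" "qRe I * qJ I = 0" "qRe I * qK I = 0"
    by (auto simp: quat_eq_iff quat_mult_sel power2_eq_square)
  have "qRe I = 0"
  proof (rule ccontr)
    assume "qRe I \<noteq> 0"
    then have "(qRe I)\<^sup>2 = -1" using e z by simp
    then show False using zero_le_power2 [of "qRe I"] by linarith
  qed
  then show "qRe I = 0 \<and> (qI I)\<^sup>2 + (qJ I)\<^sup>2 + (qK I)\<^sup>2 = 1" using e by simp
next
  assume "qRe I = 0 \<and> (qI I)\<^sup>2 + (qJ I)\<^sup>2 + (qK I)\<^sup>2 = 1"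
  then show "I \<in> imag_units"
    by (auto simp: imag_units_def quat_eq_iff quat_mult_sel power2_eq_square)
qed

lemma qcis_sel:
  assumes "I \<in> imag_units"
  shows "qRe (qcis I t) = cos t" "qI (qcis I t) = qI I * sin t"
    "qJ (qcis I t) = qJ I * sin t" "qK (qcis I t) = qK I * sin t"
  using assms by (auto simp: qcis_def quat_mult_sel imag_units_iff)

lemma norm_qcis:
  assumes "I \<in> imag_units"
  shows "norm (qcis I t) = 1"
proof -
  have "(cos t)\<^sup>2 + (qI I * sin t)\<^sup>2 + (qJ I * sin t)\<^sup>2 + (qK I * sin t)\<^sup>2
      = (cos t)\<^sup>2 + ((qI I)\<^sup>2 + (qJ I)\<^sup>2 + (qK I)\<^sup>2) * (sin t)\<^sup>2"
    by (simp add: power_mult_distrib algebra_simps)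
  also have "\<dots> = 1" using assms by (simp add: imag_units_iff)
  finally show ?thesis using assms by (simp add: norm_quat_def qcis_sel)
qed

lemma poisson_kernel_cos:
  assumes "J \<in> imag_units"
  shows "poisson_kernel J r t = (1 - r\<^sup>2) / (1 - 2 * r * cos t + r\<^sup>2)"
proof -
  have "(norm (1 - r *\<^sub>R qcis J t))\<^sup>2 = (norm (1 :: quat))\<^sup>2 - 2 * r * (1 \<bullet> qcis J t) + r\<^sup>2 * (norm (qcis J t))\<^sup>2"
    unfolding power2_norm_eq_inner inner_diff_left inner_diff_right inner_scaleR_left
      inner_scaleR_right inner_commute [of "qcis J t" 1]
    by (simp add: power2_eq_square algebra_simps)
  then show ?thesis
    using assms by (simp add: poisson_kernel_def norm_qcis inner_quat_def qcis_sel)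
qed

lemma qcis_eqD:
  assumes "I \<in> imag_units" "I' \<in> imag_units" "qcis I t = qcis I' t'"
  shows "cos t = cos t' \<and>
    (sin t = 0 \<and> sin t' = 0 \<or> I' = I \<and> sin t' = sin t \<or> I' = - I \<and> sin t' = - sin t)"
proof -
  have c: "cos t = cos t'" and e: "qI I * sin t = qI I' * sin t'" "qJ I * sin t = qJ I' * sin t'"
    "qK I * sin t = qK I' * sin t'"
    using assms(3) by (simp_all add: quat_eq_iff qcis_sel assms(1,2))
  have "(sin t)\<^sup>2 = (sin t')\<^sup>2" using c by (simp add: sin_squared_eq)
  then consider "sin t = 0" "sin t' = 0" | "sin t \<noteq> 0" "sin t' = sin t"
    | "sin t \<noteq> 0" "sin t' = - sin t"
    by (metis power2_eq_iff neg_equal_0_iff_equal)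
  then show ?thesis
  proof cases
    case 2
    then have "I' = I" using e assms by (auto simp: quat_eq_iff imag_units_iff)
    then show ?thesis using c 2 by simp
  next
    case 3
    then have "qI I * sin t = (- qI I') * sin t" "qJ I * sin t = (- qJ I') * sin t"
      "qK I * sin t = (- qK I') * sin t" using e by simp_all
    then have "qI I = - qI I'" "qJ I = - qJ I'" "qK I = - qK I'"
      using 3(1) mult_right_cancel by blast+
    then have "I' = - I"
      using assms(1,2) by (simp add: quat_eq_iff imag_units_iff)
    then show ?thesis using c 3 by simp
  qed (use c in simp)
qed

lemma slice_kernel_polar_cong:
  assumes "0 \<le> r" "0 \<le> r'"
    and I: "I \<in> imag_units" "I' \<in> imag_units" and J: "J \<in> imag_units" "J' \<in> imag_units"
    and p: "r *\<^sub>R qcis I t = r' *\<^sub>R qcis I' t'" and q: "qcis J s = qcis J' s'"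
  shows "slice_kernel_polar r I t J s = slice_kernel_polar r' I' t' J' s'"
proof -
  have r: "r' = r" using arg_cong [OF p, of norm] assms(1-4) by (simp add: norm_qcis)
  show ?thesis
  proof (cases "r = 0")
    case True
    then show ?thesis
      using r by (simp add: slice_kernel_polar_def poisson_kernel_cos J)
  next
    case False
    then have "qcis I t = qcis I' t'" using p r by simp
    define P where "P = (\<lambda>u. (1 - r\<^sup>2) / (1 - 2 * r * u + r\<^sup>2))"
    have P: "poisson_kernel J r u = P (cos u)" "poisson_kernel J' r u = P (cos u)" for u
      by (simp_all add: P_def poisson_kernel_cos J)
    from qcis_eqD [OF I \<open>qcis I t = qcis I' t'\<close>] qcis_eqD [OF J q] show ?thesis
      unfolding slice_kernel_polar_def r P cos_add cos_diff
      by (auto simp: algebra_simps)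
  qed
qed

lemma slice_kernel_eq:
  assumes "0 \<le> r" "r < 1" "I \<in> imag_units" "J \<in> imag_units"
  shows "slice_kernel (r *\<^sub>R qcis I t) (qcis J s) = slice_kernel_polar r I t J s"
  unfolding slice_kernel_def
proof (rule the_equality)
  show "\<forall>r' I' t' J' s'. 0 \<le> r' \<and> r' < 1 \<and> I' \<in> imag_units \<and> J' \<in> imag_units
      \<and> r *\<^sub>R qcis I t = r' *\<^sub>R qcis I' t' \<and> qcis J s = qcis J' s'
      \<longrightarrow> slice_kernel_polar r I t J s = slice_kernel_polar r' I' t' J' s'"
    using slice_kernel_polar_cong assms by blast
qed (use assms in blast)

end

theory Submission
  imports Defs "HOL-Probability.Probability_Measure"
begin

text \<open>
  A slice function has the form \<open>f (e\<^sup>J\<^sup>t) = a t + J * b t\<close> with \<open>a\<close> even and \<open>b\<close> odd. Since the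
  imaginary units have mean zero and square to \<open>-1\<close>, averaging over \<open>J\<close> recovers the pair: \<open>a t\<close> is
  the mean of \<open>f (e\<^sup>J\<^sup>t)\<close> and \<open>- b t\<close> is the mean of \<open>J * f (e\<^sup>J\<^sup>t)\<close>. These averages make sense for an
  arbitrary square-integrable \<open>\<phi>\<close>; after symmetrizing in \<open>t\<close> they are called \<open>slice_even \<phi>\<close> and
  \<open>slice_odd \<phi>\<close>. By Fubini and the symmetry \<open>t \<mapsto> -t\<close> of the circle, the inner product of \<open>\<phi>\<close> with a
  slice function depends on \<open>\<phi>\<close> only through this pair (\<open>L2_inner_components\<close>). Hence the slice
  function with components \<open>slice_even \<phi>\<close> and \<open>slice_odd \<phi>\<close> is an orthogonal projection of \<open>\<phi>\<close>
  (\<open>slice_projection_exists\<close>).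

  For a fixed point of the ball the kernel is \<open>u s + I * J * v s\<close>, where \<open>u\<close> and \<open>v\<close> are the even and
  odd parts in \<open>s\<close> of the real function \<open>s \<mapsto> P (t + s)\<close>. Both \<open>u s\<close> and \<open>J * v s\<close> are slice functions
  of \<open>e\<^sup>J\<^sup>s\<close>, so the integral of the kernel against \<open>\<phi>\<close> is a combination of two inner products of
  \<open>\<phi>\<close> with slice functions (\<open>slice_kernel_integral\<close>). Replacing \<open>\<phi>\<close> by any projection \<open>f\<close> of it
  changes neither of them.

  It remains to treat a slice function \<open>f\<close> with components \<open>a\<close> and \<open>b\<close>
  (\<open>slice_extension_series\<close>). The kernel integral is the circle average of
  \<open>u s * a s - v s * (I * b s)\<close>. The coefficients are the circle averages of
  \<open>cos (n s) * a s + sin (n s) * b s\<close>, because the terms odd in \<open>s\<close> cancel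
  (\<open>slice_coeff_components\<close>). Summing the series under the integral sign and using the Poisson
  series with the addition theorems turns the second expression into the first.
\<close>

section \<open>Conjugation and imaginary units\<close>

lemma qcnj_bounded_linear: "bounded_linear qcnj"
  by (rule linear_conv_bounded_linear [THEN iffD1], rule linearI)
    (simp_all add: qcnj_def quat_eq_iff)

lemma qRe_bounded_linear: "bounded_linear qRe"
  by (rule linear_conv_bounded_linear [THEN iffD1], rule linearI) simp_all

lemmas borel_measurable_qcnj [measurable] =
  borel_measurable_continuous_onI [OF linear_continuous_on [OF qcnj_bounded_linear]]
lemmas borel_measurable_qRe [measurable] =
  borel_measurable_continuous_onI [OF linear_continuous_on [OF qRe_bounded_linear]]

lemma qcnj_mult: "qcnj (p * q) = qcnj q * qcnj p"
  by (simp add: qcnj_def quat_eq_iff quat_mult_sel algebra_simps)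

lemma qcnj_add: "qcnj (p + q) = qcnj p + qcnj q"
  by (simp add: qcnj_def quat_eq_iff)

lemma qcnj_minus: "qcnj (- p) = - qcnj p"
  by (simp add: qcnj_def quat_eq_iff)

lemma qcnj_zero [simp]: "qcnj 0 = 0"
  by (simp add: qcnj_def quat_eq_iff)

lemma qcnj_of_real [simp]: "qcnj (of_real c) = of_real c"
  by (simp add: qcnj_def quat_eq_iff)

lemma norm_qcnj [simp]: "norm (qcnj q) = norm q"
  by (simp add: qcnj_def norm_quat_def)

lemma qcnj_imag_unit: "J \<in> imag_units \<Longrightarrow> qcnj J = - J"
  by (simp add: qcnj_def quat_eq_iff imag_units_iff)

lemma imag_unit_square: "J \<in> imag_units \<Longrightarrow> J * J = -1"
  by (simp add: imag_units_def power2_eq_square)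

lemma imag_unit_square_left: "J \<in> imag_units \<Longrightarrow> J * (J * q) = - q"
  by (simp add: imag_unit_square mult.assoc [symmetric])

lemma norm_imag_unit: "J \<in> imag_units \<Longrightarrow> norm J = 1"
  by (simp add: imag_units_iff norm_quat_def)

lemma borel_imag_units [measurable]: "imag_units \<in> sets borel"
proof -
  have "imag_units = (\<lambda>q. q * q) -` {-1 :: quat}"
    by (auto simp: imag_units_def power2_eq_square)
  moreover have "closed \<dots>"
    by (intro continuous_closed_vimage continuous_intros)
  ultimately show ?thesis by (metis borel_closed)
qed

section \<open>The area measure on the imaginary units\<close>

lemma sphere_coord_eq:
  "sphere_coord p = (sin (fst p) * cos (snd p)) *\<^sub>R Quat 0 1 0 0
    + (sin (fst p) * sin (snd p)) *\<^sub>R Quat 0 0 1 0 + cos (fst p) *\<^sub>R Quat 0 0 0 1"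
  by (simp add: sphere_coord_def quat_eq_iff split: prod.split)

lemma sphere_coord_imag_unit: "sphere_coord p \<in> imag_units"
proof -
  have "(sin a * cos b)\<^sup>2 + (sin a * sin b)\<^sup>2 + (cos a)\<^sup>2 = 1" for a b :: real
  proof -
    have "(sin a * cos b)\<^sup>2 + (sin a * sin b)\<^sup>2 + (cos a)\<^sup>2
        = (sin a)\<^sup>2 * ((cos b)\<^sup>2 + (sin b)\<^sup>2) + (cos a)\<^sup>2"
      by (simp only: power_mult_distrib algebra_simps)
    then show ?thesis by simp
  qed
  then show ?thesis by (simp add: imag_units_iff sphere_coord_def split: prod.split)
qed

lemma space_unit_area [simp]: "space unit_area = imag_units"
  by (simp add: unit_area_def space_restrict_space)

lemma sets_unit_area [simp, measurable_cong]:
  "sets unit_area = sets (restrict_space borel imag_units)"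
  by (simp add: unit_area_def)

text \<open>The density of the area measure with the parameter rectangle built in. As a product of a
  function of the polar angle and one of the azimuth it is integrated by iterating.\<close>

definition area_weight :: "real \<times> real \<Rightarrow> real" where
  "area_weight p = indicator {0..pi} (fst p) * sin (fst p) / (4 * pi)
     * indicator {0..2 * pi} (snd p)"

lemma area_weight_measurable [measurable]: "area_weight \<in> borel_measurable borel"
proof -
  have "area_weight \<in> borel_measurable (borel \<Otimes>\<^sub>M borel)"
    unfolding area_weight_def by measurable
  then show ?thesis by (simp only: borel_prod)
qed

lemma area_weight_nonneg: "0 \<le> area_weight p"
  by (auto simp: area_weight_def indicator_def sin_ge_zero)

lemma sphere_coord_measurable [measurable]:
  "sphere_coord \<in> borel_measurable borel"
  unfolding sphere_coord_eq [abs_def]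
  by (intro borel_measurable_continuous_onI continuous_intros)

lemma sphere_coord_measurable_unit_area:
  "sphere_coord \<in> measurable borel (restrict_space borel imag_units)"
  by (rule measurable_restrict_space2) (auto simp: sphere_coord_imag_unit)

text \<open>Carrying the restriction to the parameter rectangle in the density gives an image of
  Lebesgue measure on the whole plane, to which Fubini applies.\<close>

lemma unit_area_eq:
  "unit_area = distr (density lborel (\<lambda>p. ennreal (area_weight p)))
     (restrict_space borel imag_units) sphere_coord"
proof (rule measure_eqI)
  let ?R = "{0..pi} \<times> {0..2 * pi}"
  have R: "?R \<in> sets borel"
    by (intro borel_closed closed_Times) auto
  have g: "(\<lambda>(\<theta>, \<omega>). ennreal (sin \<theta> / (4 * pi))) = (\<lambda>p::real\<times>real. ennreal (sin (fst p) / (4 * pi)))"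
    by auto
  have gm: "(\<lambda>p::real\<times>real. ennreal (sin (fst p) / (4 * pi))) \<in> borel_measurable borel"
    by (intro measurable_compose [OF _ measurable_ennreal] borel_measurable_continuous_onI continuous_intros) auto
  fix A assume "A \<in> sets unit_area"
  then have A: "A \<in> sets (restrict_space borel imag_units)" by simp
  have vm: "sphere_coord -` A \<in> sets borel"
    using measurable_sets [OF sphere_coord_measurable_unit_area A] by simp
  have sp: "space (density (restrict_space lborel ?R) (\<lambda>p. ennreal (sin (fst p) / (4 * pi)))) = ?R"
    by (simp add: space_restrict_space)
  have mR: "sphere_coord \<in> measurable (density (restrict_space lborel ?R) (\<lambda>p. ennreal (sin (fst p) / (4 * pi))))
      (restrict_space borel imag_units)"
    using measurable_restrict_space1 [OF sphere_coord_measurable_unit_area, of ?R]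
    by (simp cong: measurable_cong_sets)
  have "emeasure unit_area A = emeasure (density (restrict_space lborel ?R) (\<lambda>p. ennreal (sin (fst p) / (4 * pi))))
      (sphere_coord -` A \<inter> ?R)"
    unfolding unit_area_def g
    by (subst emeasure_distr) (use mR A sp in auto)
  also have "\<dots> = (\<integral>\<^sup>+p. ennreal (sin (fst p) / (4 * pi)) * indicator (sphere_coord -` A \<inter> ?R) p
       \<partial>restrict_space lborel ?R)"
    by (rule emeasure_density)
      (use gm vm R in \<open>auto simp: sets_restrict_space intro!: measurable_restrict_space1\<close>)
  also have "\<dots> = (\<integral>\<^sup>+p. ennreal (sin (fst p) / (4 * pi)) * indicator (sphere_coord -` A \<inter> ?R) p * indicator ?R p \<partial>lborel)"
    by (subst nn_integral_restrict_space) (use R in auto)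
  also have "\<dots> = (\<integral>\<^sup>+p. ennreal (area_weight p) * indicator (sphere_coord -` A) p \<partial>lborel)"
    by (intro nn_integral_cong) (auto simp: area_weight_def indicator_def)
  also have "\<dots> = emeasure (density lborel (\<lambda>p. ennreal (area_weight p))) (sphere_coord -` A)"
    using vm by (subst emeasure_density) auto
  also have "\<dots> = emeasure (distr (density lborel (\<lambda>p. ennreal (area_weight p)))
     (restrict_space borel imag_units) sphere_coord) A"
    using A sphere_coord_measurable_unit_area
    by (subst emeasure_distr) (auto cong: measurable_cong_sets)
  finally show "emeasure unit_area A = emeasure (distr (density lborel (\<lambda>p. ennreal (area_weight p)))
     (restrict_space borel imag_units) sphere_coord) A" .
qed simp

lemma unit_area_integral:
  fixes h :: "quat \<Rightarrow> 'b::{banach, second_countable_topology}"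
  assumes h: "h \<in> borel_measurable unit_area"
  shows "(LINT J|unit_area. h J) = (LINT p|lborel. area_weight p *\<^sub>R h (sphere_coord p))"
proof -
  have h': "h \<in> borel_measurable (restrict_space borel imag_units)"
    using h by (simp cong: measurable_cong_sets)
  have hs: "(\<lambda>p. h (sphere_coord p)) \<in> borel_measurable borel"
    using measurable_compose [OF sphere_coord_measurable_unit_area h'] .
  show ?thesis
    unfolding unit_area_eq
    using h' hs sphere_coord_measurable_unit_area
    by (subst integral_distr) (auto simp: integral_density area_weight_nonneg cong: measurable_cong_sets)
qed

lemma integral_over_interval:
  fixes f :: "real \<Rightarrow> real"
  assumes "a \<le> b" "\<And>x. (F has_real_derivative f x) (at x)" "\<And>x. isCont f x"
    "c = F b - F a"
  shows "has_bochner_integral lborel (\<lambda>x. indicator {a..b} x * f x) c"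
  using has_bochner_integral_FTC_Icc_real [OF assms(1), of F f] assms(2-4)
  by (auto simp: has_bochner_integral_iff mult.commute)

lemma lborel_integral_product:
  fixes f g :: "real \<Rightarrow> real"
  assumes f': "has_bochner_integral lborel f a" and g': "has_bochner_integral lborel g b"
  shows "has_bochner_integral (lborel :: (real \<times> real) measure) (\<lambda>p. f (fst p) * g (snd p)) (a * b)"
proof -
  have f: "integrable lborel f" "(LINT x|lborel. f x) = a"
    and g: "integrable lborel g" "(LINT x|lborel. g x) = b"
    using f' g' by (simp_all add: has_bochner_integral_iff)
  have [measurable]: "f \<in> borel_measurable borel" "g \<in> borel_measurable borel"
    using f g by (auto dest: borel_measurable_integrable)
  have i: "integrable (lborel \<Otimes>\<^sub>M lborel) (\<lambda>p. f (fst p) * g (snd p))"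
    using f g by (intro lborel_pair.Fubini_integrable) (auto simp: abs_mult)
  have "(LINT p|(lborel \<Otimes>\<^sub>M lborel). f (fst p) * g (snd p)) = a * b"
    by (subst lborel_pair.integral_fst' [OF i, symmetric]) (simp add: f g)
  then show ?thesis
    using i by (simp add: has_bochner_integral_iff lborel_prod)
qed

text \<open>The two factors of the density have integrals \<open>1 / (2 * pi)\<close> and \<open>2 * pi\<close>.\<close>

lemma prob_space_unit_area: "prob_space unit_area"
proof
  have 1: "has_bochner_integral lborel (\<lambda>x::real. indicator {0..pi} x * (sin x / (4 * pi))) (1 / (2 * pi))"
    by (rule integral_over_interval [where F = "\<lambda>x. - cos x / (4 * pi)"])
      (auto intro!: derivative_eq_intros continuous_intros)
  have 2: "has_bochner_integral lborel (\<lambda>x::real. indicator {0..2*pi} x * 1) (2 * pi)"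
    by (rule integral_over_interval [where F = "\<lambda>x. x"]) auto
  have hb: "has_bochner_integral lborel area_weight 1"
    using lborel_integral_product [OF 1 2] by (simp add: area_weight_def [abs_def])
  have "imag_units \<in> sets (restrict_space borel imag_units)"
    by (simp add: sets_restrict_space_iff)
  then have "emeasure unit_area (space unit_area) = (\<integral>\<^sup>+p. ennreal (area_weight p) \<partial>lborel)"
    unfolding unit_area_eq using sphere_coord_measurable_unit_area
    by (subst emeasure_distr)
      (auto simp: emeasure_density space_restrict_space sphere_coord_imag_unit vimage_def cong: measurable_cong_sets)
  also have "\<dots> = ennreal 1"
    using hb by (subst nn_integral_eq_integral) (auto simp: has_bochner_integral_iff area_weight_nonneg)
  finally show "emeasure unit_area (space unit_area) = 1" by simp
qed

interpretation unit_area: prob_space unit_area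
  by (rule prob_space_unit_area)

lemma borel_measurable_unit_area_id [measurable]: "(\<lambda>J. J) \<in> borel_measurable unit_area"
  by (simp add: measurable_restrict_space1 cong: measurable_cong_sets)

lemma integrable_unit_area_id: "integrable unit_area (\<lambda>J. J)"
  by (rule unit_area.integrable_const_bound [where B = 1]) (auto simp: norm_imag_unit intro!: AE_I2)

text \<open>The first two coordinates vanish on integrating the azimuth (cosine and sine over a full
  period), the third on integrating the polar angle, since \<open>sin x * cos x\<close> is odd about \<open>pi / 2\<close>.\<close>

lemma unit_area_mean_zero: "(LINT J|unit_area. J) = 0"
proof -
  define a b :: "real \<Rightarrow> real"
    where "a = (\<lambda>x. indicator {0..pi} x * (sin x * sin x / (4 * pi)))"
      and "b = (\<lambda>x. indicator {0..pi} x * (sin x * cos x / (4 * pi)))"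
  define c s u :: "real \<Rightarrow> real"
    where "c = (\<lambda>x. indicator {0..2*pi} x * cos x)"
      and "s = (\<lambda>x. indicator {0..2*pi} x * sin x)"
      and "u = (\<lambda>x. indicator {0..2*pi} x * 1)"
  have a: "has_bochner_integral lborel a (integral\<^sup>L lborel a)"
    unfolding a_def
    using borel_integrable_atLeastAtMost' [of 0 pi "\<lambda>x. sin x * sin x / (4 * pi)"]
    by (simp add: set_integrable_def has_bochner_integral_iff continuous_intros)
  have b: "has_bochner_integral lborel b 0"
    unfolding b_def
    by (rule integral_over_interval [where F = "\<lambda>x. (sin x)\<^sup>2 / (8 * pi)"])
      (auto intro!: derivative_eq_intros continuous_intros)
  have c: "has_bochner_integral lborel c 0"
    unfolding c_def by (rule integral_over_interval [where F = sin]) auto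
  have s: "has_bochner_integral lborel s 0"
    unfolding s_def
    by (rule integral_over_interval [where F = "\<lambda>x. - cos x"]) (auto intro!: derivative_eq_intros)
  have u: "has_bochner_integral lborel u (2 * pi)"
    unfolding u_def by (rule integral_over_interval [where F = "\<lambda>x. x"]) auto
  have *: "has_bochner_integral lborel (\<lambda>p. (a (fst p) * c (snd p)) *\<^sub>R Quat 0 1 0 0
      + (a (fst p) * s (snd p)) *\<^sub>R Quat 0 0 1 0 + (b (fst p) * u (snd p)) *\<^sub>R Quat 0 0 0 1)
      ((integral\<^sup>L lborel a * 0) *\<^sub>R Quat 0 1 0 0
      + (integral\<^sup>L lborel a * 0) *\<^sub>R Quat 0 0 1 0 + (0 * (2 * pi)) *\<^sub>R Quat 0 0 0 1)"
    by (intro has_bochner_integral_add has_bochner_integral_scaleR_left lborel_integral_product a b c s u)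
  have "(LINT J|unit_area. J) = (LINT p|lborel. area_weight p *\<^sub>R sphere_coord p)"
    by (rule unit_area_integral) simp
  also have "\<dots> = (LINT p|lborel. (a (fst p) * c (snd p)) *\<^sub>R Quat 0 1 0 0
      + (a (fst p) * s (snd p)) *\<^sub>R Quat 0 0 1 0 + (b (fst p) * u (snd p)) *\<^sub>R Quat 0 0 0 1)"
    unfolding a_def b_def c_def s_def u_def
    by (intro Bochner_Integration.integral_cong)
      (auto simp: area_weight_def sphere_coord_eq indicator_def quat_eq_iff)
  also have "\<dots> = 0"
    using has_bochner_integral_integral_eq [OF *] by simp
  finally show ?thesis .
qed

section \<open>The circle\<close>

definition circle_measure :: "real measure" where
  "circle_measure = uniform_measure lborel {0..2 * pi}"

lemma circle_measure_eq:
  "circle_measure = density lborel (\<lambda>t. ennreal (indicator {0..2 * pi} t / (2 * pi)))"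
  unfolding circle_measure_def uniform_measure_def
  by (intro density_cong) (auto simp: indicator_def divide_ennreal ennreal_1 [symmetric] simp del: ennreal_1)

lemma sets_circle_measure [simp, measurable_cong]: "sets circle_measure = sets borel"
  and space_circle_measure [simp]: "space circle_measure = UNIV"
  by (simp_all add: circle_measure_def)

interpretation circle: prob_space circle_measure
  unfolding circle_measure_def by (rule prob_space_uniform_measure) auto

lemma integrable_circle_iff:
  fixes h :: "real \<Rightarrow> 'b::{banach, second_countable_topology}"
  assumes [measurable]: "h \<in> borel_measurable borel"
  shows "integrable circle_measure h \<longleftrightarrow> integrable lborel (\<lambda>t. indicator {0..2 * pi} t *\<^sub>R h t)"
proof -
  let ?f = "\<lambda>t. indicator {0..2 * pi} t *\<^sub>R h t"
  have eq: "(\<lambda>t. (indicator {0..2 * pi} t / (2 * pi)) *\<^sub>R h t) = (\<lambda>t. (1 / (2 * pi)) *\<^sub>R ?f t)"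
    by auto
  have "integrable circle_measure h \<longleftrightarrow> integrable lborel (\<lambda>t. (1 / (2 * pi)) *\<^sub>R ?f t)"
    unfolding circle_measure_eq eq [symmetric] by (intro integrable_density) auto
  also have "\<dots> \<longleftrightarrow> integrable lborel ?f"
  proof
    assume "integrable lborel (\<lambda>t. (1 / (2 * pi)) *\<^sub>R ?f t)"
    from integrable_scaleR_right [OF this, of "2 * pi"] show "integrable lborel ?f" by simp
  qed (rule integrable_scaleR_right)
  finally show ?thesis .
qed

lemma integral_circle_eq:
  fixes h :: "real \<Rightarrow> 'b::{banach, second_countable_topology}"
  assumes [measurable]: "h \<in> borel_measurable borel"
  shows "(LINT t|circle_measure. h t) = (1 / (2 * pi)) *\<^sub>R (LINT t:{0..2 * pi}|lborel. h t)"
proof -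
  have "(LINT t|circle_measure. h t) = (LINT t|lborel. (indicator {0..2 * pi} t / (2 * pi)) *\<^sub>R h t)"
    unfolding circle_measure_eq by (intro integral_density) auto
  also have "\<dots> = (LINT t|lborel. (1 / (2 * pi)) *\<^sub>R (indicator {0..2 * pi} t *\<^sub>R h t))"
    by (intro Bochner_Integration.integral_cong) auto
  also have "\<dots> = (1 / (2 * pi)) *\<^sub>R (LINT t:{0..2 * pi}|lborel. h t)"
    unfolding set_lebesgue_integral_def by (rule integral_scaleR_right)
  finally show ?thesis .
qed

text \<open>The reflection \<open>t \<mapsto> 2 * pi - t\<close> preserves the fundamental interval, and by periodicity it
  acts on \<open>h\<close> as \<open>t \<mapsto> -t\<close>.\<close>

lemma circle_reflect:
  fixes h :: "real \<Rightarrow> 'b::{banach, second_countable_topology}"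
  assumes [measurable]: "h \<in> borel_measurable borel" and per: "\<And>t. h (t + 2 * pi) = h t"
  shows integrable_circle_reflect: "integrable circle_measure (\<lambda>t. h (- t)) \<longleftrightarrow> integrable circle_measure h"
    and integral_circle_reflect: "(LINT t|circle_measure. h (- t)) = (LINT t|circle_measure. h t)"
proof -
  let ?f = "\<lambda>t. indicator {0..2 * pi} t *\<^sub>R h t"
  have "?f (2 * pi + -1 * t) = indicator {0..2 * pi} t *\<^sub>R h (- t)" for t
    using per [of "- t"] by (auto simp: indicator_def algebra_simps)
  then have eq: "(\<lambda>t. indicator {0..2 * pi} t *\<^sub>R h (- t)) = (\<lambda>t. ?f (2 * pi + -1 * t))" by metis
  show "integrable circle_measure (\<lambda>t. h (- t)) \<longleftrightarrow> integrable circle_measure h"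
    using lborel_integrable_real_affine_iff [of "-1" ?f "2 * pi"] eq by (simp add: integrable_circle_iff)
  show "(LINT t|circle_measure. h (- t)) = (LINT t|circle_measure. h t)"
    using lborel_integral_real_affine [of "-1" ?f "2 * pi"] eq
    by (simp add: integral_circle_eq set_lebesgue_integral_def)
qed

text \<open>Fourier coefficients are defined by integrals over \<open>[-pi, pi]\<close>, the measure on the sphere by
  integrals over \<open>[0, 2 * pi]\<close>: the left half of the first interval is moved by one period.\<close>

lemma circle_symmetric_interval:
  fixes h :: "real \<Rightarrow> 'b::{banach, second_countable_topology}"
  assumes [measurable]: "h \<in> borel_measurable borel" and per: "\<And>t. h (t + 2 * pi) = h t"
    and int: "integrable circle_measure h"
  shows "(1 / (2 * pi)) *\<^sub>R (LINT t:{-pi..pi}|lborel. h t) = (LINT t|circle_measure. h t)"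
proof -
  let ?f = "\<lambda>A t. indicator A t *\<^sub>R h t"
  \<comment> \<open>Half-open pieces are disjoint and translate exactly; the endpoints are null.\<close>
  have i: "set_integrable lborel {0..2*pi} h"
    using int by (simp add: integrable_circle_iff set_integrable_def)
  have i1: "integrable lborel (?f {0..<pi})" and i2: "integrable lborel (?f {pi..<2*pi})"
    unfolding set_integrable_def [symmetric] by (rule set_integrable_subset [OF i]; use pi_gt_zero in auto)+
  have "?f {-pi..<0} (-2*pi + 1 * t) = ?f {pi..<2*pi} t" for t
    using per [of "-2 * pi + t"] by (auto simp: indicator_def)
  then have eq: "?f {pi..<2*pi} = (\<lambda>t. ?f {-pi..<0} (-2*pi + 1 * t))" by metis
  have i3: "integrable lborel (?f {-pi..<0})"
    using i2 unfolding eq by (subst (asm) lborel_integrable_real_affine_iff) auto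
  have e3: "(LINT t|lborel. ?f {-pi..<0} t) = (LINT t|lborel. ?f {pi..<2*pi} t)"
    unfolding eq by (subst lborel_integral_real_affine [of 1 _ "-2*pi"]) auto
  have "(LINT t:{-pi..pi}|lborel. h t) = (LINT t|lborel. ?f {-pi..<0} t + ?f {0..<pi} t)"
    unfolding set_lebesgue_integral_def
  proof (rule integral_cong_AE)
    show "AE t in lborel. ?f {-pi..pi} t = ?f {-pi..<0} t + ?f {0..<pi} t"
      using AE_lborel_singleton [of pi] by eventually_elim (auto simp: indicator_def)
  qed auto
  also have "\<dots> = (LINT t|lborel. ?f {pi..<2*pi} t) + (LINT t|lborel. ?f {0..<pi} t)"
    using i3 i1 e3 by simp
  also have "\<dots> = (LINT t|lborel. ?f {pi..<2*pi} t + ?f {0..<pi} t)"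
    using i1 i2 by simp
  also have "\<dots> = (LINT t:{0..2*pi}|lborel. h t)"
    unfolding set_lebesgue_integral_def
  proof (rule integral_cong_AE)
    show "AE t in lborel. ?f {pi..<2*pi} t + ?f {0..<pi} t = ?f {0..2*pi} t"
      using AE_lborel_singleton [of "2 * pi"] by eventually_elim (auto simp: indicator_def)
  qed auto
  finally show ?thesis by (simp add: integral_circle_eq)
qed

section \<open>Polar coordinates on the sphere\<close>

lemma qcis_periodic [simp]: "qcis J (t + 2 * pi) = qcis J t" "qcis J (- (t + 2 * pi)) = qcis J (- t)"
proof -
  show "qcis J (t + 2 * pi) = qcis J t" by (simp add: qcis_def)
  show "qcis J (- (t + 2 * pi)) = qcis J (- t)"
    unfolding qcis_def cos_minus sin_minus by simp
qed

lemma sphere_polar: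
  assumes "norm q = 1"
  obtains J t where "J \<in> imag_units" "q = qcis J t"
proof -
  define v where "v = q - of_real (qRe q)"
  have n: "(qRe q)\<^sup>2 + (qI q)\<^sup>2 + (qJ q)\<^sup>2 + (qK q)\<^sup>2 = 1"
    using assms by (simp add: norm_quat_def)
  have nv: "(norm v)\<^sup>2 = 1 - (qRe q)\<^sup>2"
    using n by (simp add: v_def norm_quat_def)
  have "0 \<le> (norm v)\<^sup>2" by simp
  then have "(qRe q)\<^sup>2 \<le> 1" using nv by linarith
  then have b: "\<bar>qRe q\<bar> \<le> 1" by (simp add: abs_square_le_1)
  define t where "t = arccos (qRe q)"
  have c: "cos t = qRe q" using b by (simp add: t_def cos_arccos_abs)
  have s: "sin t = norm v"
    using b nv by (simp add: t_def sin_arccos_abs real_sqrt_unique)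
  show ?thesis
  proof (cases "v = 0")
    case True
    have "Quat 0 1 0 0 \<in> imag_units" by (simp add: imag_units_iff)
    moreover have "q = qcis (Quat 0 1 0 0) t"
      using True s c by (simp add: qcis_def v_def)
    ultimately show ?thesis by (rule that)
  next
    case False
    have "norm (sgn v) = 1" using False by (simp add: norm_sgn)
    moreover have "qRe (sgn v) = 0" by (simp add: sgn_quat_def v_def)
    ultimately have "sgn v \<in> imag_units"
      by (simp add: imag_units_iff norm_quat_def)
    moreover have "q = qcis (sgn v) t"
    proof -
      have "sgn v * of_real (norm v) = v"
        using False by (simp add: sgn_quat_def of_real_def)
      then show ?thesis using s c by (simp add: qcis_def v_def)
    qed
    ultimately show ?thesis by (rule that)
  qed
qed

lemma space_sphere_measure [simp]: "space sphere_measure = sphere 0 1"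
  and sets_sphere_measure [simp, measurable_cong]:
    "sets sphere_measure = sets (restrict_space borel (sphere 0 1))"
  by (simp_all add: sphere_measure_def space_restrict_space)

interpretation torus: pair_prob_space circle_measure unit_area ..

lemma qcis_measurable_torus [measurable]:
  "(\<lambda>(t, J). qcis J t) \<in> measurable (circle_measure \<Otimes>\<^sub>M unit_area) (restrict_space borel (sphere 0 1))"
proof (rule measurable_restrict_space2)
  show "(\<lambda>(t, J). qcis J t) \<in> space (circle_measure \<Otimes>\<^sub>M unit_area) \<rightarrow> sphere 0 1"
    by (auto simp: space_pair_measure norm_qcis)
  have of_real_measurable: "(of_real :: real \<Rightarrow> quat) \<in> borel_measurable borel"
    by (intro borel_measurable_continuous_onI continuous_intros)
  note [measurable] = measurable_compose [OF _ of_real_measurable]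
  show "(\<lambda>(t, J). qcis J t) \<in> borel_measurable (circle_measure \<Otimes>\<^sub>M unit_area)"
    unfolding qcis_def by measurable
qed

lemma sphere_measure_eq:
  "sphere_measure = distr (circle_measure \<Otimes>\<^sub>M unit_area) (restrict_space borel (sphere 0 1))
     (\<lambda>(t, J). qcis J t)"
  by (simp add: sphere_measure_def circle_measure_def)

interpretation sphere: prob_space sphere_measure
  unfolding sphere_measure_eq by (rule torus.prob_space_distr) simp

lemma polar_measurable:
  assumes "h \<in> borel_measurable sphere_measure"
  shows "(\<lambda>(t, J). h (qcis J t)) \<in> borel_measurable (circle_measure \<Otimes>\<^sub>M unit_area)"
proof -
  have "h \<in> borel_measurable (restrict_space borel (sphere 0 1))"
    using assms by (simp cong: measurable_cong_sets)
  from measurable_compose [OF qcis_measurable_torus this] show ?thesis by (simp add: case_prod_beta')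
qed

lemma polar_integrable_iff:
  fixes h :: "quat \<Rightarrow> 'b::{banach, second_countable_topology}"
  assumes "h \<in> borel_measurable sphere_measure"
  shows "integrable sphere_measure h \<longleftrightarrow>
    integrable (circle_measure \<Otimes>\<^sub>M unit_area) (\<lambda>(t, J). h (qcis J t))"
proof -
  have "h \<in> borel_measurable (restrict_space borel (sphere 0 1))"
    using assms by (simp cong: measurable_cong_sets)
  then show ?thesis
    unfolding sphere_measure_eq
    by (subst integrable_distr_eq) (auto simp: case_prod_beta')
qed

text \<open>The iterated form of the integral over the sphere: first over the imaginary units, then over
  the circle. The inner integrals exist for almost every angle.\<close>

lemma polar_integral:
  fixes h :: "quat \<Rightarrow> 'b::{banach, second_countable_topology}"
  assumes "integrable sphere_measure h"
  shows "(LINT q|sphere_measure. h q) = (LINT t|circle_measure. LINT J|unit_area. h (qcis J t))"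
    and "integrable circle_measure (\<lambda>t. LINT J|unit_area. h (qcis J t))"
    and "AE t in circle_measure. integrable unit_area (\<lambda>J. h (qcis J t))"
proof -
  have m: "h \<in> borel_measurable sphere_measure" using assms by auto
  then have m': "h \<in> borel_measurable (restrict_space borel (sphere 0 1))"
    by (simp cong: measurable_cong_sets)
  have i: "integrable (circle_measure \<Otimes>\<^sub>M unit_area) (\<lambda>(t, J). h (qcis J t))"
    using assms polar_integrable_iff [OF m] by simp
  have "(LINT q|sphere_measure. h q) = (LINT p|(circle_measure \<Otimes>\<^sub>M unit_area). (case p of (t, J) \<Rightarrow> h (qcis J t)))"
    using m' unfolding sphere_measure_eq by (subst integral_distr) (auto simp: case_prod_beta')
  also have "\<dots> = (LINT t|circle_measure. LINT J|unit_area. h (qcis J t))"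
    using torus.integral_fst' [OF i] by simp
  finally show "(LINT q|sphere_measure. h q) = (LINT t|circle_measure. LINT J|unit_area. h (qcis J t))" .
  show "integrable circle_measure (\<lambda>t. LINT J|unit_area. h (qcis J t))"
    using torus.integrable_fst' [OF i] by simp
  show "AE t in circle_measure. integrable unit_area (\<lambda>J. h (qcis J t))"
    using torus.AE_integrable_fst' [OF i] by simp
qed

lemma polar_section_measurable:
  assumes "h \<in> borel_measurable sphere_measure"
  shows "(\<lambda>J. h (qcis J t)) \<in> borel_measurable unit_area"
  using measurable_Pair2 [OF polar_measurable [OF assms], of t] by simp

lemma polar_average_measurable:
  fixes h :: "quat \<Rightarrow> quat"
  assumes "h \<in> borel_measurable sphere_measure"
  shows "(\<lambda>t. LINT J|unit_area. h (qcis J t)) \<in> borel_measurable borel"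
    "(\<lambda>t. LINT J|unit_area. J * h (qcis J t)) \<in> borel_measurable borel"
proof -
  note [measurable] = polar_measurable [OF assms]
  have "(\<lambda>t. LINT J|unit_area. h (qcis J t)) \<in> borel_measurable circle_measure"
    by measurable
  then show "(\<lambda>t. LINT J|unit_area. h (qcis J t)) \<in> borel_measurable borel" by simp
  have "(\<lambda>(t, J). J * h (qcis J t)) \<in> borel_measurable (circle_measure \<Otimes>\<^sub>M unit_area)"
    by measurable
  then have "(\<lambda>t. LINT J|unit_area. J * h (qcis J t)) \<in> borel_measurable circle_measure"
    by measurable
  then show "(\<lambda>t. LINT J|unit_area. J * h (qcis J t)) \<in> borel_measurable borel" by simp
qed

section \<open>Slice components\<close>

text \<open>For a slice function \<open>a t + J * b t\<close> the averages of \<open>f\<close> and of \<open>J * f\<close> are \<open>a t\<close> and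
  \<open>- b t\<close>. The definitions take the even part of the first average and minus the odd part of the
  second, so that the parities, and with them a well-defined slice function, are available for
  every \<open>f\<close>, including angles at which an average is a non-existing integral with value 0.\<close>

definition slice_even :: "(quat \<Rightarrow> quat) \<Rightarrow> real \<Rightarrow> quat" where
  "slice_even f t = (1/2) *\<^sub>R ((LINT J|unit_area. f (qcis J t)) + (LINT J|unit_area. f (qcis J (- t))))"

definition slice_odd :: "(quat \<Rightarrow> quat) \<Rightarrow> real \<Rightarrow> quat" where
  "slice_odd f t =
     (1/2) *\<^sub>R ((LINT J|unit_area. J * f (qcis J (- t))) - (LINT J|unit_area. J * f (qcis J t)))"

lemma slice_even_minus [simp]: "slice_even f (- t) = slice_even f t"
  by (simp add: slice_even_def add.commute)

lemma slice_odd_minus [simp]: "slice_odd f (- t) = - slice_odd f t"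
  by (simp add: slice_odd_def flip: scaleR_minus_right)

lemma slice_even_periodic [simp]: "slice_even f (t + 2 * pi) = slice_even f t"
  by (simp only: slice_even_def qcis_periodic)

lemma slice_odd_periodic [simp]: "slice_odd f (t + 2 * pi) = slice_odd f t"
  by (simp only: slice_odd_def qcis_periodic)

lemma slice_components_measurable:
  assumes "f \<in> borel_measurable sphere_measure"
  shows "slice_even f \<in> borel_measurable borel" "slice_odd f \<in> borel_measurable borel"
proof -
  note [measurable] = polar_average_measurable [OF assms]
  have [measurable]: "(\<lambda>t. LINT J|unit_area. f (qcis J (- t))) \<in> borel_measurable borel"
    "(\<lambda>t. LINT J|unit_area. J * f (qcis J (- t))) \<in> borel_measurable borel"
    by (rule measurable_compose [where g = "\<lambda>t. LINT J|unit_area. f (qcis J t)" and f = uminus]; measurable)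
      (rule measurable_compose [where g = "\<lambda>t. LINT J|unit_area. J * f (qcis J t)" and f = uminus]; measurable)
  show "slice_even f \<in> borel_measurable borel" "slice_odd f \<in> borel_measurable borel"
    unfolding slice_even_def [abs_def] slice_odd_def [abs_def] by measurable
qed

lemma integrable_imag_unit_mult:
  assumes "integrable unit_area f"
  shows "integrable unit_area (\<lambda>J. J * f J)"
  by (rule Bochner_Integration.integrable_bound [OF assms])
    (use assms in \<open>auto simp: norm_mult norm_imag_unit intro!: AE_I2\<close>)

lemma integrable_sphere_imag_average:
  assumes "integrable sphere_measure f"
  shows "integrable circle_measure (\<lambda>t. LINT J|unit_area. J * f (qcis J t))"
proof -
  have m: "f \<in> borel_measurable sphere_measure" using assms by auto
  note [measurable] = polar_measurable [OF m]
  have i: "integrable (circle_measure \<Otimes>\<^sub>M unit_area) (\<lambda>(t, J). f (qcis J t))"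
    using assms polar_integrable_iff [OF m] by simp
  have "integrable (circle_measure \<Otimes>\<^sub>M unit_area) (\<lambda>(t, J). J * f (qcis J t))"
    by (rule Bochner_Integration.integrable_bound [OF i])
      (auto simp: norm_mult norm_imag_unit space_pair_measure intro!: AE_I2)
  then show ?thesis using torus.integrable_fst' by fastforce
qed

lemma slice_components_integrable:
  assumes "integrable sphere_measure f"
  shows "integrable circle_measure (slice_even f)" "integrable circle_measure (slice_odd f)"
proof -
  have m: "f \<in> borel_measurable sphere_measure" using assms by auto
  note i0 = polar_integral(2) [OF assms] and i1 = integrable_sphere_imag_average [OF assms]
  have "integrable circle_measure (\<lambda>t. LINT J|unit_area. f (qcis J (- t)))"
    by (subst integrable_circle_reflect [where h = "\<lambda>t. LINT J|unit_area. f (qcis J t)"])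
      (use i0 polar_average_measurable [OF m] in simp_all)
  then show "integrable circle_measure (slice_even f)"
    unfolding slice_even_def [abs_def] using i0 by simp
  have "integrable circle_measure (\<lambda>t. LINT J|unit_area. J * f (qcis J (- t)))"
    by (subst integrable_circle_reflect [where h = "\<lambda>t. LINT J|unit_area. J * f (qcis J t)"])
      (use i1 polar_average_measurable [OF m] in simp_all)
  then show "integrable circle_measure (slice_odd f)"
    unfolding slice_odd_def [abs_def] using i1 by simp
qed

lemma unit_area_average_affine:
  fixes a b :: quat
  shows "(LINT J|unit_area. a + J * b) = a" "(LINT J|unit_area. J * (a + J * b)) = - b"
proof -
  have i: "integrable unit_area (\<lambda>J. J * c)" for c :: quat
    using integrable_unit_area_id by simp
  have z: "(LINT J|unit_area. J * c) = 0" for c :: quat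
    using integrable_unit_area_id by (simp add: unit_area_mean_zero)
  show "(LINT J|unit_area. a + J * b) = a"
    using i z by (simp add: unit_area.prob_space [simplified])
  have "(LINT J|unit_area. J * (a + J * b)) = (LINT J|unit_area. J * a + - b)"
    by (intro Bochner_Integration.integral_cong) (auto simp: distrib_left imag_unit_square_left)
  also have "\<dots> = - b"
    using i z by (subst Bochner_Integration.integral_add) (simp_all add: unit_area.prob_space [simplified])
  finally show "(LINT J|unit_area. J * (a + J * b)) = - b" .
qed

text \<open>A slice function is determined by its components, and averaging recovers them: the mean of
  \<open>J\<close> is zero and \<open>J * J = -1\<close>.\<close>

lemma slice_components_unique:
  assumes "\<And>J t. J \<in> imag_units \<Longrightarrow> f (qcis J t) = a t + J * b t"
    and "\<And>t. a (- t) = a t" "\<And>t. b (- t) = - b t"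
  shows "slice_even f = a" "slice_odd f = b"
proof -
  have *: "(LINT J|unit_area. f (qcis J t)) = a t" "(LINT J|unit_area. J * f (qcis J t)) = - b t" for t
  proof -
    have "(LINT J|unit_area. f (qcis J t)) = (LINT J|unit_area. a t + J * b t)"
      by (intro Bochner_Integration.integral_cong) (auto simp: assms(1))
    then show "(LINT J|unit_area. f (qcis J t)) = a t" by (simp only: unit_area_average_affine)
    have "(LINT J|unit_area. J * f (qcis J t)) = (LINT J|unit_area. J * (a t + J * b t))"
      by (intro Bochner_Integration.integral_cong) (auto simp: assms(1))
    then show "(LINT J|unit_area. J * f (qcis J t)) = - b t" by (simp only: unit_area_average_affine)
  qed
  show "slice_even f = a" "slice_odd f = b"
    by (auto simp: slice_even_def slice_odd_def * assms(2,3) fun_eq_iff simp flip: scaleR_2)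
qed

lemma half_scaleR_add_self: "(1/2) *\<^sub>R (q + q) = (q :: 'a::real_vector)"
  by (simp flip: scaleR_2)

lemma slice_functionI:
  assumes "\<And>J t. J \<in> imag_units \<Longrightarrow> f (qcis J t) = a t + J * b t"
    and "\<And>t. a (- t) = a t" "\<And>t. b (- t) = - b t"
  shows "slice_function f"
  unfolding slice_function_def
proof (intro ballI allI)
  fix I J t assume I: "I \<in> imag_units" and J: "J \<in> imag_units"
  have "(1/2) *\<^sub>R (f (qcis I t) + f (qcis I (- t))) = a t"
    using I by (simp add: assms half_scaleR_add_self)
  moreover have "(1/2) *\<^sub>R (J * I * (f (qcis I (- t)) - f (qcis I t))) = J * b t"
  proof -
    have "J * I * (f (qcis I (- t)) - f (qcis I t)) = J * b t + J * b t"
      using I by (simp add: assms mult.assoc right_diff_distrib distrib_left imag_unit_square_left)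
    then show ?thesis by (simp only: half_scaleR_add_self)
  qed
  ultimately show "f (qcis J t) = (1/2) *\<^sub>R (f (qcis I t) + f (qcis I (- t)))
      + (1/2) *\<^sub>R (J * I * (f (qcis I (- t)) - f (qcis I t)))"
    using J by (simp add: assms)
qed

text \<open>The representation formula of a slice function with respect to one unit exhibits it in the
  form \<open>a t + K * b t\<close> for all units \<open>K\<close>.\<close>

lemma slice_function_components:
  assumes "slice_function f" "J \<in> imag_units"
  shows "f (qcis J t) = slice_even f t + J * slice_odd f t"
proof -
  define a where "a t = (1/2) *\<^sub>R (f (qcis J t) + f (qcis J (- t)))" for t
  define b where "b t = (1/2) *\<^sub>R (J * (f (qcis J (- t)) - f (qcis J t)))" for t
  have f: "f (qcis K t) = a t + K * b t" if "K \<in> imag_units" for K t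
  proof -
    have "f (qcis K t) = (1/2) *\<^sub>R (f (qcis J t) + f (qcis J (- t)))
        + (1/2) *\<^sub>R (K * J * (f (qcis J (- t)) - f (qcis J t)))"
      using assms that unfolding slice_function_def by blast
    then show ?thesis by (simp only: a_def b_def mult_scaleR_right mult.assoc)
  qed
  have "a (- t) = a t" for t by (simp add: a_def add.commute)
  moreover have "b (- t) = - b t" for t
    unfolding b_def scaleR_minus_right [symmetric] mult_minus_right [symmetric] by simp
  ultimately have "slice_even f = a" "slice_odd f = b"
    using slice_components_unique [of f a b] f by blast+
  with f assms(2) show ?thesis by simp
qed

text \<open>The key identity. Writing \<open>g = c + J * d\<close>, conjugation gives
  \<open>qcnj g = qcnj c - qcnj d * J\<close>, so integrating over \<open>J\<close> leaves the averages of \<open>f\<close> and \<open>J * f\<close>.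
  As \<open>c\<close> is even and \<open>d\<close> odd, the integral over the circle sees only the even part of the first
  and the odd part of the second.\<close>

lemma L2_inner_components:
  assumes g: "slice_function g" "g \<in> borel_measurable sphere_measure"
    and f: "integrable sphere_measure f" and fg: "integrable sphere_measure (\<lambda>q. qcnj (g q) * f q)"
  shows "L2_inner f g = (LINT t|circle_measure.
      qcnj (slice_even g t) * slice_even f t + qcnj (slice_odd g t) * slice_odd f t)"
proof -
  define c d where "c = slice_even g" and "d = slice_odd g"
  define m0 where "m0 t = (LINT J|unit_area. f (qcis J t))" for t
  define m1 where "m1 t = (LINT J|unit_area. J * f (qcis J t))" for t
  \<comment> \<open>Fubini yields this integrand only almost everywhere. It is periodic at every \<open>t\<close>, so it can be
    symmetrized without tracking the exceptional null set under reflection.\<close>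
  define k where "k t = qcnj (c t) * m0 t - qcnj (d t) * m1 t" for t
  have mf: "f \<in> borel_measurable sphere_measure" using f by auto
  have [measurable]: "m0 \<in> borel_measurable borel" "m1 \<in> borel_measurable borel"
    unfolding m0_def [abs_def] m1_def [abs_def] by (rule polar_average_measurable [OF mf])+
  have [measurable]: "c \<in> borel_measurable borel" "d \<in> borel_measurable borel"
    unfolding c_def d_def by (rule slice_components_measurable [OF g(2)])+
  have km [measurable]: "k \<in> borel_measurable borel"
    unfolding k_def [abs_def] by measurable
  have cd: "c (- t) = c t" "d (- t) = - d t" for t
    by (simp_all add: c_def d_def)
  have per: "k (t + 2 * pi) = k t" for t
    unfolding k_def c_def d_def m0_def m1_def by simp
  have ae: "AE t in circle_measure. (LINT J|unit_area. qcnj (g (qcis J t)) * f (qcis J t)) = k t"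
    using polar_integral(3) [OF f]
  proof eventually_elim
    case (elim t)
    have i1: "integrable unit_area (\<lambda>J. J * f (qcis J t))"
      by (rule integrable_imag_unit_mult) (use elim in auto)
    have "(LINT J|unit_area. qcnj (g (qcis J t)) * f (qcis J t))
        = (LINT J|unit_area. qcnj (c t) * f (qcis J t) - qcnj (d t) * (J * f (qcis J t)))"
    proof (rule Bochner_Integration.integral_cong)
      fix J assume "J \<in> space unit_area"
      then have J: "J \<in> imag_units" by simp
      show "qcnj (g (qcis J t)) * f (qcis J t) = qcnj (c t) * f (qcis J t) - qcnj (d t) * (J * f (qcis J t))"
        unfolding slice_function_components [OF g(1) J]
        by (simp add: c_def d_def qcnj_add qcnj_mult qcnj_imag_unit [OF J] algebra_simps)
    qed simp
    also have "\<dots> = k t"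
      using elim i1 by (simp add: k_def m0_def m1_def)
    finally show ?case .
  qed
  have ik: "integrable circle_measure k"
    using polar_integral(2) [OF fg] ae by (subst integrable_cong_AE [symmetric]) auto
  have ik': "integrable circle_measure (\<lambda>t. k (- t))"
    using integrable_circle_reflect [OF km per] ik by simp
  have "L2_inner f g = (LINT t|circle_measure. k t)"
    unfolding L2_inner_def polar_integral(1) [OF fg]
    using ae polar_integral(2) [OF fg] by (intro integral_cong_AE) auto
  also have "\<dots> = (1/2) *\<^sub>R ((LINT t|circle_measure. k t) + (LINT t|circle_measure. k (- t)))"
    using integral_circle_reflect [OF km per] by (simp add: half_scaleR_add_self)
  also have "\<dots> = (LINT t|circle_measure. (1/2) *\<^sub>R (k t + k (- t)))"
    using ik ik' by simp
  also have "\<dots> = (LINT t|circle_measure. qcnj (c t) * slice_even f t + qcnj (d t) * slice_odd f t)"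
    by (intro Bochner_Integration.integral_cong)
      (auto simp: k_def cd slice_even_def [of f] slice_odd_def [of f] m0_def [symmetric]
        m1_def [symmetric] qcnj_minus algebra_simps)
  finally show ?thesis by (simp add: c_def d_def)
qed

section \<open>Slice functions with prescribed components\<close>

text \<open>A point of the sphere is written as \<open>e\<^sup>J\<^sup>t\<close> with \<open>t\<close> in \<open>[0, pi]\<close> and \<open>J\<close> the direction of its
  imaginary part. At \<open>1\<close> and \<open>-1\<close>, where there is no direction, \<open>sgn 0 = 0\<close> drops the second term.\<close>

definition slice_of :: "(real \<Rightarrow> quat) \<Rightarrow> (real \<Rightarrow> quat) \<Rightarrow> quat \<Rightarrow> quat" where
  "slice_of a b q = a (arccos (qRe q)) + sgn (q - of_real (qRe q)) * b (arccos (qRe q))"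

lemma periodic_int_multiple:
  fixes a :: "real \<Rightarrow> 'b"
  assumes "\<And>t. a (t + 2 * pi) = a t"
  shows "a (t + 2 * of_int n * pi) = a t"
proof -
  have nat: "a (t + 2 * of_nat n * pi) = a t" for n t
  proof (induction n)
    case (Suc n)
    have "a (t + 2 * of_nat (Suc n) * pi) = a ((t + 2 * of_nat n * pi) + 2 * pi)"
      by (simp add: algebra_simps)
    then show ?case using assms Suc by simp
  qed simp
  show ?thesis
  proof (cases n rule: int_cases2)
    case (nonneg m) then show ?thesis using nat [of t m] by simp
  next
    case (nonpos m) then show ?thesis using nat [of "t + 2 * of_int n * pi" m] by simp
  qed
qed

text \<open>Other angles differ from the one in \<open>[0, pi]\<close> by a period and possibly a sign; the sign is
  absorbed by the parities. At the two real points an odd periodic \<open>b\<close> vanishes.\<close>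

lemma slice_of_qcis:
  assumes J: "J \<in> imag_units"
    and a: "\<And>t. a (- t) = a t" "\<And>t. a (t + 2 * pi) = a t"
    and b: "\<And>t. b (- t) = - b t" "\<And>t. b (t + 2 * pi) = b t"
  shows "slice_of a b (qcis J t) = a t + J * b t"
proof -
  define u where "u = arccos (cos t)"
  have sg: "sgn (qcis J t - of_real (qRe (qcis J t))) = sgn (sin t) *\<^sub>R J"
  proof -
    have "qcis J t - of_real (qRe (qcis J t)) = sin t *\<^sub>R J"
      using J by (simp add: qcis_sel) (simp add: qcis_def of_real_def)
    moreover have "sgn J = J" using J by (simp add: sgn_quat_def norm_imag_unit)
    ultimately show ?thesis by (simp add: sgn_scaleR)
  qed
  have q: "slice_of a b (qcis J t) = a u + sgn (sin t) *\<^sub>R (J * b u)"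
    using J sg by (simp add: slice_of_def u_def qcis_sel(1))
  have u: "0 \<le> u" "u \<le> pi" "cos u = cos t" by (auto simp: u_def arccos_lbound arccos_ubound)
  have su: "0 \<le> sin u" using u by (simp add: sin_ge_zero)
  \<comment> \<open>\<open>b 0 = - b 0\<close>, and \<open>b pi = b (- pi) = - b pi\<close> by periodicity.\<close>
  have b0: "b u = 0" if "sin u = 0"
  proof -
    have half: "x = 0" if "x = - x" for x :: quat using that by (simp add: quat_eq_iff)
    have "b 0 = 0" using b(1) [of 0] half by simp
    moreover have "b pi = 0" using b(1) [of pi] b(2) [of "- pi"] half by simp
    ultimately show ?thesis
      using that u sin_eq_0_pi [of u] by (cases "u = pi") auto
  qed
  from u(3) obtain n where n: "n \<in> \<int>" "t = u + 2 * n * pi \<or> t = - u + 2 * n * pi"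
    using cos_eq [of t u] by auto
  then obtain m where m: "n = of_int m" by (auto elim: Ints_cases)
  have shift: "sin (x + 2 * of_int m * pi) = sin x" for x :: real
    by (rule periodic_int_multiple) simp
  from n(2) show ?thesis
  proof
    assume t: "t = u + 2 * n * pi"
    have "a t = a u" "b t = b u" "sin t = sin u"
      unfolding t m using a b shift by (simp_all only: periodic_int_multiple)
    then show ?thesis using q su b0 by (cases "sin u = 0") auto
  next
    assume t: "t = - u + 2 * n * pi"
    have "a t = a u" "b t = - b u" "sin t = - sin u"
      unfolding t m using a b shift by (simp_all only: periodic_int_multiple sin_minus)
    then show ?thesis using q su b0 by (cases "sin u = 0") auto
  qed
qed

lemma slice_of_measurable:
  assumes [measurable]: "a \<in> borel_measurable borel" "b \<in> borel_measurable borel"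
  shows "slice_of a b \<in> borel_measurable sphere_measure"
proof -
  have id: "(\<lambda>q. q) \<in> borel_measurable sphere_measure"
    by (simp add: measurable_restrict_space1 cong: measurable_cong_sets)
  have re: "qRe \<in> measurable sphere_measure (restrict_space borel {-1..1})"
  proof (rule measurable_restrict_space2)
    show "qRe \<in> space sphere_measure \<rightarrow> {-1..1}"
    proof
      fix q :: quat assume "q \<in> space sphere_measure"
      then have "norm q = 1" by simp
      then obtain J t where "J \<in> imag_units" "q = qcis J t" by (rule sphere_polar)
      then show "qRe q \<in> {-1..1}" by (simp add: qcis_sel)
    qed
    show "qRe \<in> borel_measurable sphere_measure"
      using measurable_compose [OF id borel_measurable_qRe] .
  qed
  have "arccos \<in> borel_measurable (restrict_space borel {-1..1})"
    by (rule borel_measurable_continuous_on_restrict) (rule continuous_on_arccos')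
  from measurable_compose [OF re this]
  have ac [measurable]: "(\<lambda>q. arccos (qRe q)) \<in> borel_measurable sphere_measure" .
  have "(\<lambda>q::quat. sgn (q - of_real (qRe q))) \<in> borel_measurable borel"
    unfolding of_real_def by measurable
  from measurable_compose [OF id this]
  have [measurable]: "(\<lambda>q::quat. sgn (q - of_real (qRe q))) \<in> borel_measurable sphere_measure" .
  show ?thesis
    unfolding slice_of_def [abs_def] by measurable
qed

section \<open>Square-integrable functions and the projection\<close>

lemma L2_measurable: "f \<in> L2 \<Longrightarrow> f \<in> borel_measurable sphere_measure"
  and L2_norm_square: "f \<in> L2 \<Longrightarrow> integrable sphere_measure (\<lambda>q. (norm (f q))\<^sup>2)"
  by (simp_all add: L2_def)

lemma L2_integrable:
  assumes "f \<in> L2"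
  shows "integrable sphere_measure f"
proof -
  have "integrable sphere_measure (\<lambda>q. norm (f q))"
    by (rule sphere.square_integrable_imp_integrable)
      (use L2_measurable [OF assms] L2_norm_square [OF assms] in auto)
  then show ?thesis
    using L2_measurable [OF assms] by (simp add: integrable_norm_iff)
qed

lemma L2_product_integrable:
  assumes "f \<in> L2" "g \<in> L2"
  shows "integrable sphere_measure (\<lambda>q. qcnj (g q) * f q)"
proof (rule Bochner_Integration.integrable_bound)
  show "integrable sphere_measure (\<lambda>q. (norm (f q))\<^sup>2 + (norm (g q))\<^sup>2)"
    using assms by (simp add: L2_norm_square)
  note [measurable] = L2_measurable [OF assms(1)] L2_measurable [OF assms(2)]
  show "(\<lambda>q. qcnj (g q) * f q) \<in> borel_measurable sphere_measure" by measurable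
  have "b * a \<le> a\<^sup>2 + b\<^sup>2" if "0 \<le> a" "0 \<le> b" for a b :: real
  proof -
    have "2 * (b * a) \<le> a\<^sup>2 + b\<^sup>2" using sum_squares_bound [of a b] by (simp add: mult_ac)
    then show ?thesis using mult_nonneg_nonneg [OF that] by (simp add: mult.commute)
  qed
  then show "AE q in sphere_measure. norm (qcnj (g q) * f q) \<le> norm ((norm (f q))\<^sup>2 + (norm (g q))\<^sup>2)"
    by (intro AE_I2) (simp add: norm_mult)
qed

lemma L2_inner_diff:
  assumes "\<phi> \<in> L2" "f \<in> L2" "g \<in> L2"
  shows "L2_inner (\<lambda>q. \<phi> q - f q) g = L2_inner \<phi> g - L2_inner f g"
  using L2_product_integrable [OF assms(1,3)] L2_product_integrable [OF assms(2,3)]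
  by (simp add: L2_inner_def right_diff_distrib)

lemma norm_add_square_le:
  fixes x y :: "'a::real_normed_vector"
  shows "(norm (x + y))\<^sup>2 \<le> 2 * (norm x)\<^sup>2 + 2 * (norm y)\<^sup>2"
proof -
  have "(norm (x + y))\<^sup>2 \<le> (norm x + norm y)\<^sup>2"
    by (intro power_mono norm_triangle_ineq) simp
  also have "\<dots> \<le> 2 * (norm x)\<^sup>2 + 2 * (norm y)\<^sup>2"
    using sum_squares_bound [of "norm x" "norm y"] by (simp add: power2_sum)
  finally show ?thesis .
qed

lemma slice_of_L2:
  assumes a: "a \<in> borel_measurable borel" "\<And>t. a (- t) = a t" "\<And>t. a (t + 2 * pi) = a t"
      "integrable circle_measure (\<lambda>t. (norm (a t))\<^sup>2)"
    and b: "b \<in> borel_measurable borel" "\<And>t. b (- t) = - b t" "\<And>t. b (t + 2 * pi) = b t"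
      "integrable circle_measure (\<lambda>t. (norm (b t))\<^sup>2)"
  shows "slice_of a b \<in> L2_slice" "slice_even (slice_of a b) = a" "slice_odd (slice_of a b) = b"
proof -
  have q: "slice_of a b (qcis J t) = a t + J * b t" if "J \<in> imag_units" for J t
    using that a(2,3) b(2,3) by (rule slice_of_qcis)
  have m [measurable]: "slice_of a b \<in> borel_measurable sphere_measure"
    by (rule slice_of_measurable [OF a(1) b(1)])
  note [measurable] = a(1) b(1) polar_measurable [OF m]
  have *: "integrable (circle_measure \<Otimes>\<^sub>M unit_area) (\<lambda>(t, J). 2 * (norm (a t))\<^sup>2 + 2 * (norm (b t))\<^sup>2)"
    using a(4) b(4) by (intro torus.Fubini_integrable) (auto simp: unit_area.prob_space [simplified])
  have "integrable (circle_measure \<Otimes>\<^sub>M unit_area) (\<lambda>(t, J). (norm (slice_of a b (qcis J t)))\<^sup>2)"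
  proof (rule Bochner_Integration.integrable_bound [OF *])
    show "(\<lambda>(t, J). (norm (slice_of a b (qcis J t)))\<^sup>2) \<in> borel_measurable (circle_measure \<Otimes>\<^sub>M unit_area)"
      by measurable
    show "AE p in circle_measure \<Otimes>\<^sub>M unit_area. norm (case p of (t, J) \<Rightarrow> (norm (slice_of a b (qcis J t)))\<^sup>2)
        \<le> norm (case p of (t, J) \<Rightarrow> 2 * (norm (a t))\<^sup>2 + 2 * (norm (b t))\<^sup>2)"
    proof (rule AE_I2, clarsimp simp: space_pair_measure)
      fix t J assume J: "J \<in> imag_units"
      show "(norm (slice_of a b (qcis J t)))\<^sup>2 \<le> 2 * (norm (a t))\<^sup>2 + 2 * (norm (b t))\<^sup>2"
        using norm_add_square_le [of "a t" "J * b t"] J by (simp add: q norm_mult norm_imag_unit)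
    qed
  qed
  then have "integrable sphere_measure (\<lambda>q. (norm (slice_of a b q))\<^sup>2)"
    by (subst polar_integrable_iff) auto
  moreover have "slice_function (slice_of a b)"
    using q a(2) b(2) by (rule slice_functionI)
  ultimately show "slice_of a b \<in> L2_slice" using m by (simp add: L2_slice_def L2_def)
  show "slice_even (slice_of a b) = a" "slice_odd (slice_of a b) = b"
    using slice_components_unique [of "slice_of a b" a b] q a(2) b(2) by blast+
qed

text \<open>The variance of the norm of \<open>X\<close> is nonnegative.\<close>

lemma (in prob_space) norm_expectation_square_le:
  fixes X :: "'a \<Rightarrow> 'b::{banach, second_countable_topology}"
  assumes [measurable]: "X \<in> borel_measurable M" and sq: "integrable M (\<lambda>x. (norm (X x))\<^sup>2)"
  shows "(norm (expectation X))\<^sup>2 \<le> expectation (\<lambda>x. (norm (X x))\<^sup>2)"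
proof -
  define m where "m = expectation (\<lambda>x. norm (X x))"
  have i: "integrable M (\<lambda>x. norm (X x))"
    by (rule square_integrable_imp_integrable) (use sq in auto)
  have "0 \<le> expectation (\<lambda>x. (norm (X x) - m)\<^sup>2)" by simp
  also have "\<dots> = expectation (\<lambda>x. (norm (X x))\<^sup>2 - 2 * m * norm (X x) + m\<^sup>2)"
    by (intro Bochner_Integration.integral_cong) (auto simp: power2_diff)
  also have "\<dots> = expectation (\<lambda>x. (norm (X x))\<^sup>2) - m\<^sup>2"
    using i sq by (simp add: prob_space m_def [symmetric] power2_eq_square)
  finally have "m\<^sup>2 \<le> expectation (\<lambda>x. (norm (X x))\<^sup>2)" by simp
  moreover have "(norm (expectation X))\<^sup>2 \<le> m\<^sup>2"
    unfolding m_def by (intro power_mono integral_norm_bound) simp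
  ultimately show ?thesis by linarith
qed

text \<open>Each average over the units is bounded, by Jensen, by the average of the squared norm, which is
  integrable over the circle; multiplication by \<open>J\<close> does not change norms.\<close>

lemma slice_components_square_integrable:
  assumes f: "f \<in> L2"
  shows "integrable circle_measure (\<lambda>t. (norm (slice_even f t))\<^sup>2)"
    "integrable circle_measure (\<lambda>t. (norm (slice_odd f t))\<^sup>2)"
proof -
  note m = L2_measurable [OF f]
  note sq = L2_norm_square [OF f]
  note [measurable] = slice_components_measurable [OF m]
  define m0 where "m0 t = (LINT J|unit_area. f (qcis J t))" for t
  define m1 where "m1 t = (LINT J|unit_area. J * f (qcis J t))" for t
  have mm [measurable]: "m0 \<in> borel_measurable borel" "m1 \<in> borel_measurable borel"
    unfolding m0_def [abs_def] m1_def [abs_def] by (rule polar_average_measurable [OF m])+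
  have per: "m0 (t + 2 * pi) = m0 t" "m1 (t + 2 * pi) = m1 t" for t
    by (simp_all add: m0_def m1_def)
  have bound: "AE t in circle_measure. (norm (m0 t))\<^sup>2 \<le> (LINT J|unit_area. (norm (f (qcis J t)))\<^sup>2)
      \<and> (norm (m1 t))\<^sup>2 \<le> (LINT J|unit_area. (norm (f (qcis J t)))\<^sup>2)"
    using polar_integral(3) [OF sq]
  proof eventually_elim
    case (elim t)
    note [measurable] = polar_section_measurable [OF m, of t]
    have eq: "(norm (J * f (qcis J t)))\<^sup>2 = (norm (f (qcis J t)))\<^sup>2" if "J \<in> space unit_area" for J
      using that by (simp add: norm_mult norm_imag_unit)
    have "integrable unit_area (\<lambda>J. (norm (J * f (qcis J t)))\<^sup>2)"
      using elim by (subst Bochner_Integration.integrable_cong [OF refl eq])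
    then have "(norm (m1 t))\<^sup>2 \<le> (LINT J|unit_area. (norm (J * f (qcis J t)))\<^sup>2)"
      unfolding m1_def by (intro unit_area.norm_expectation_square_le) auto
    also have "\<dots> = (LINT J|unit_area. (norm (f (qcis J t)))\<^sup>2)"
      by (intro Bochner_Integration.integral_cong refl eq)
    finally show ?case
      unfolding m0_def using elim by (auto intro!: unit_area.norm_expectation_square_le)
  qed
  \<comment> \<open>\<open>k\<close> stands for either average and \<open>h\<close> for its symmetrization; the alternatives cover the
    even part and the odd part.\<close>
  have *: "integrable circle_measure (\<lambda>t. (norm (h t))\<^sup>2)"
    if k: "k \<in> borel_measurable borel" "\<And>t. k (t + 2 * pi) = k t"
      "AE t in circle_measure. (norm (k t))\<^sup>2 \<le> (LINT J|unit_area. (norm (f (qcis J t)))\<^sup>2)"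
      and h: "h \<in> borel_measurable borel" "\<And>t. norm (h t) \<le> norm (k t + k (- t)) \<or> norm (h t) \<le> norm (k (- t) - k t)"
    for h k :: "real \<Rightarrow> quat"
  proof -
    note [measurable] = k(1) h(1)
    have i: "integrable circle_measure (\<lambda>t. (norm (k t))\<^sup>2)"
      by (rule Bochner_Integration.integrable_bound [OF polar_integral(2) [OF sq]])
        (use k(3) in \<open>auto elim!: eventually_mono\<close>)
    have i': "integrable circle_measure (\<lambda>t. (norm (k (- t)))\<^sup>2)"
      by (subst integrable_circle_reflect [where h = "\<lambda>t. (norm (k t))\<^sup>2"]) (use k(2) i in auto)
    show ?thesis
    proof (rule Bochner_Integration.integrable_bound)
      show "integrable circle_measure (\<lambda>t. 2 * (norm (k t))\<^sup>2 + 2 * (norm (k (- t)))\<^sup>2)"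
        using i i' by simp
      show "AE t in circle_measure. norm ((norm (h t))\<^sup>2) \<le> norm (2 * (norm (k t))\<^sup>2 + 2 * (norm (k (- t)))\<^sup>2)"
      proof (rule AE_I2)
        fix t
        from h(2) [of t] have "(norm (h t))\<^sup>2 \<le> (norm (k t + k (- t)))\<^sup>2 \<or> (norm (h t))\<^sup>2 \<le> (norm (k (- t) - k t))\<^sup>2"
          by (meson norm_ge_zero power_mono)
        moreover have "(norm (k (- t) - k t))\<^sup>2 \<le> 2 * (norm (k t))\<^sup>2 + 2 * (norm (k (- t)))\<^sup>2"
          using norm_add_square_le [of "k (- t)" "- k t"] by simp
        ultimately have "(norm (h t))\<^sup>2 \<le> 2 * (norm (k t))\<^sup>2 + 2 * (norm (k (- t)))\<^sup>2"
          using norm_add_square_le [of "k t" "k (- t)"] by linarith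
        then show "norm ((norm (h t))\<^sup>2) \<le> norm (2 * (norm (k t))\<^sup>2 + 2 * (norm (k (- t)))\<^sup>2)"
          by simp
      qed
    qed measurable
  qed
  show "integrable circle_measure (\<lambda>t. (norm (slice_even f t))\<^sup>2)"
    by (rule * [of m0]) (use mm per bound in \<open>auto simp: slice_even_def m0_def [symmetric]\<close>)
  show "integrable circle_measure (\<lambda>t. (norm (slice_odd f t))\<^sup>2)"
    by (rule * [of m1]) (use mm per bound in \<open>auto simp: slice_odd_def m1_def [symmetric]\<close>)
qed

text \<open>This slice function has the same components as \<open>\<phi>\<close>, hence the same inner product with every
  square-integrable slice function.\<close>

lemma slice_projection_exists:
  assumes \<phi>: "\<phi> \<in> L2"
  shows "is_slice_projection \<phi> (slice_of (slice_even \<phi>) (slice_odd \<phi>))"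
proof -
  let ?f = "slice_of (slice_even \<phi>) (slice_odd \<phi>)"
  have f: "?f \<in> L2_slice" "slice_even ?f = slice_even \<phi>" "slice_odd ?f = slice_odd \<phi>"
    by (rule slice_of_L2; simp add: slice_components_measurable [OF L2_measurable [OF \<phi>]]
        slice_components_square_integrable [OF \<phi>])+
  then have fL: "?f \<in> L2" by (simp add: L2_slice_def)
  show ?thesis
    unfolding is_slice_projection_def
  proof (intro conjI ballI f(1))
    fix g assume "g \<in> L2_slice"
    then have g: "g \<in> L2" "slice_function g" by (simp_all add: L2_slice_def)
    have "L2_inner \<phi> g = L2_inner ?f g"
      using g \<phi> fL
      by (simp add: L2_inner_components L2_measurable L2_integrable L2_product_integrable f)
    then show "L2_inner (\<lambda>q. \<phi> q - ?f q) g = 0"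
      using L2_inner_diff [OF \<phi> fL g(1)] by simp
  qed
qed

section \<open>The kernel as a pair of slice functions\<close>

definition poisson :: "real \<Rightarrow> real \<Rightarrow> real" where
  "poisson r t = (1 - r\<^sup>2) / (1 - 2 * r * cos t + r\<^sup>2)"

lemma poisson_denominator:
  fixes r t :: real
  assumes "0 \<le> r" "r < 1"
  shows "0 < 1 - 2 * r * cos t + r\<^sup>2" "(1 - r)\<^sup>2 \<le> 1 - 2 * r * cos t + r\<^sup>2"
proof -
  have "r * cos t \<le> r" using assms mult_left_mono [of "cos t" 1 r] by simp
  then show *: "(1 - r)\<^sup>2 \<le> 1 - 2 * r * cos t + r\<^sup>2" by (simp add: power2_diff)
  have "0 < (1 - r)\<^sup>2" using assms by simp
  then show "0 < 1 - 2 * r * cos t + r\<^sup>2" using * by linarith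
qed

lemma poisson_periodic: "poisson r (t + 2 * pi) = poisson r t"
  by (simp add: poisson_def)

lemma abs_poisson_le:
  assumes "0 \<le> r" "r < 1"
  shows "\<bar>poisson r t\<bar> \<le> (1 - r\<^sup>2) / (1 - r)\<^sup>2"
proof -
  have "0 \<le> 1 - r\<^sup>2" using assms by (simp add: power_le_one)
  then show ?thesis
    unfolding poisson_def using poisson_denominator [OF assms, of t] assms
    by (simp add: frac_le)
qed

lemma poisson_measurable [measurable]: "poisson r \<in> borel_measurable borel"
  unfolding poisson_def [abs_def] by measurable

text \<open>\<open>kernel_even\<close> and \<open>kernel_odd\<close> are the even and odd parts of \<open>poisson r (t + s)\<close> in \<open>s\<close>, which is what
  makes them components of slice functions.\<close>

definition kernel_even :: "real \<Rightarrow> real \<Rightarrow> real \<Rightarrow> real" where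
  "kernel_even r t s = (poisson r (t + s) + poisson r (t - s)) / 2"

definition kernel_odd :: "real \<Rightarrow> real \<Rightarrow> real \<Rightarrow> real" where
  "kernel_odd r t s = (poisson r (t + s) - poisson r (t - s)) / 2"

lemma kernel_measurable [measurable]:
  "kernel_even r t \<in> borel_measurable borel" "kernel_odd r t \<in> borel_measurable borel"
  unfolding kernel_even_def [abs_def] kernel_odd_def [abs_def] by measurable

lemma kernel_bounded:
  assumes "0 \<le> r" "r < 1"
  obtains C where "\<And>s. \<bar>kernel_even r t s\<bar> \<le> C" "\<And>s. \<bar>kernel_odd r t s\<bar> \<le> C"
proof -
  define C where "C = (1 - r\<^sup>2) / (1 - r)\<^sup>2"
  have C: "\<bar>poisson r x\<bar> \<le> C" for x
    unfolding C_def by (rule abs_poisson_le [OF assms])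
  have "\<bar>kernel_even r t s\<bar> \<le> C" "\<bar>kernel_odd r t s\<bar> \<le> C" for s
    using C [of "t + s"] C [of "t - s"] by (auto simp: kernel_even_def kernel_odd_def)
  then show ?thesis by (rule that)
qed

definition even_kernel_slice :: "real \<Rightarrow> real \<Rightarrow> quat \<Rightarrow> quat" where
  "even_kernel_slice r t = slice_of (\<lambda>s. of_real (kernel_even r t s)) (\<lambda>_. 0)"

definition odd_kernel_slice :: "real \<Rightarrow> real \<Rightarrow> quat \<Rightarrow> quat" where
  "odd_kernel_slice r t = slice_of (\<lambda>_. 0) (\<lambda>s. of_real (kernel_odd r t s))"

lemma kernel_component_slices:
  fixes r t :: real
  assumes r: "0 \<le> r" "r < 1"
  defines "g1 \<equiv> even_kernel_slice r t" and "g2 \<equiv> odd_kernel_slice r t"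
  shows "g1 \<in> L2_slice" "slice_even g1 = (\<lambda>s. of_real (kernel_even r t s))" "slice_odd g1 = (\<lambda>_. 0)"
    and "g2 \<in> L2_slice" "slice_even g2 = (\<lambda>_. 0)" "slice_odd g2 = (\<lambda>s. of_real (kernel_odd r t s))"
proof -
  obtain C where "\<And>s. \<bar>kernel_even r t s\<bar> \<le> C" "\<And>s. \<bar>kernel_odd r t s\<bar> \<le> C"
    using kernel_bounded [OF r] by blast
  then have b: "(kernel_even r t s)\<^sup>2 \<le> C\<^sup>2" "(kernel_odd r t s)\<^sup>2 \<le> C\<^sup>2" for s
    by (auto simp: abs_le_square_iff [symmetric] intro: order_trans [OF _ abs_ge_self])
  have m: "(\<lambda>s. of_real (kernel_even r t s) :: quat) \<in> borel_measurable borel"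
    "(\<lambda>s. of_real (kernel_odd r t s) :: quat) \<in> borel_measurable borel"
    unfolding of_real_def by measurable
  have p: "poisson r (t + (s + 2 * pi)) = poisson r (t + s)" "poisson r (t - (s + 2 * pi)) = poisson r (t - s)" for s
    using poisson_periodic [of r "t + s"] poisson_periodic [of r "t - (s + 2 * pi)"] by (simp_all add: algebra_simps)
  have par: "kernel_even r t (- s) = kernel_even r t s" "kernel_odd r t (- s) = - kernel_odd r t s"
    "kernel_even r t (s + 2 * pi) = kernel_even r t s" "kernel_odd r t (s + 2 * pi) = kernel_odd r t s" for s
    by (simp_all only: kernel_even_def kernel_odd_def p) (simp_all add: field_simps)
  have i: "integrable circle_measure (\<lambda>s. (kernel_even r t s)\<^sup>2)" "integrable circle_measure (\<lambda>s. (kernel_odd r t s)\<^sup>2)"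
    by (rule circle.integrable_const_bound [where B = "C\<^sup>2"]; use b in simp)+
  show "g1 \<in> L2_slice" "slice_even g1 = (\<lambda>s. of_real (kernel_even r t s))" "slice_odd g1 = (\<lambda>_. 0)"
    unfolding g1_def even_kernel_slice_def by (rule slice_of_L2; use m i in \<open>simp add: par\<close>)+
  show "g2 \<in> L2_slice" "slice_even g2 = (\<lambda>_. 0)" "slice_odd g2 = (\<lambda>s. of_real (kernel_odd r t s))"
    unfolding g2_def odd_kernel_slice_def by (rule slice_of_L2; use m i in \<open>simp add: par\<close>)+
qed

text \<open>Since \<open>qcnj (J * v) = - (J * v)\<close> for real \<open>v\<close>, the term \<open>I * J * v\<close> of the kernel is
  \<open>- I * qcnj (J * v)\<close>, in the form in which it enters an inner product.\<close>

lemma slice_kernel_components: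
  fixes r t :: real
  assumes "0 \<le> r" "r < 1" "I \<in> imag_units" "norm q = 1"
  defines "g1 \<equiv> even_kernel_slice r t" and "g2 \<equiv> odd_kernel_slice r t"
  shows "slice_kernel (r *\<^sub>R qcis I t) q = qcnj (g1 q) - I * qcnj (g2 q)"
proof -
  obtain J s where J: "J \<in> imag_units" and q: "q = qcis J s"
    using assms(4) by (rule sphere_polar)
  have g: "g1 \<in> L2_slice" "g2 \<in> L2_slice"
    unfolding g1_def g2_def by (rule kernel_component_slices [OF assms(1,2)])+
  have "g1 q = of_real (kernel_even r t s)" "g2 q = J * of_real (kernel_odd r t s)"
    using g kernel_component_slices [OF assms(1,2), of t] J
    by (simp_all add: q L2_slice_def slice_function_components g1_def g2_def)
  moreover have "slice_kernel (r *\<^sub>R qcis I t) q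
      = of_real (kernel_even r t s) + I * J * of_real (kernel_odd r t s)"
    unfolding q slice_kernel_eq [OF assms(1-3) J] slice_kernel_polar_def
    by (simp add: kernel_even_def kernel_odd_def poisson_def poisson_kernel_cos [OF J] of_real_def)
  ultimately show ?thesis
    by (simp add: qcnj_mult qcnj_imag_unit [OF J]) (simp add: of_real_def)
qed

lemma slice_kernel_integral:
  fixes r t :: real
  assumes r: "0 \<le> r" "r < 1" and I: "I \<in> imag_units" and f: "f \<in> L2"
  defines "g1 \<equiv> even_kernel_slice r t" and "g2 \<equiv> odd_kernel_slice r t"
  shows "integrable sphere_measure (\<lambda>q. slice_kernel (r *\<^sub>R qcis I t) q * f q)"
    and "(LINT q|sphere_measure. slice_kernel (r *\<^sub>R qcis I t) q * f q) = L2_inner f g1 - I * L2_inner f g2"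
proof -
  have g: "g1 \<in> L2" "g2 \<in> L2"
    using kernel_component_slices [OF r, of t] by (simp_all add: g1_def g2_def L2_slice_def)
  note i = L2_product_integrable [OF f g(1)] L2_product_integrable [OF f g(2)]
  have eq: "slice_kernel (r *\<^sub>R qcis I t) q * f q = qcnj (g1 q) * f q - I * (qcnj (g2 q) * f q)"
    if "q \<in> space sphere_measure" for q
    using slice_kernel_components [OF r I, of q t] that
    by (simp add: g1_def g2_def left_diff_distrib mult.assoc)
  show "integrable sphere_measure (\<lambda>q. slice_kernel (r *\<^sub>R qcis I t) q * f q)"
    using i by (subst Bochner_Integration.integrable_cong [OF refl eq]) auto
  have "(LINT q|sphere_measure. slice_kernel (r *\<^sub>R qcis I t) q * f q)
      = (LINT q|sphere_measure. qcnj (g1 q) * f q - I * (qcnj (g2 q) * f q))"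
    by (intro Bochner_Integration.integral_cong refl eq)
  also have "\<dots> = L2_inner f g1 - I * L2_inner f g2"
    using i by (simp add: L2_inner_def)
  finally show "(LINT q|sphere_measure. slice_kernel (r *\<^sub>R qcis I t) q * f q) = L2_inner f g1 - I * L2_inner f g2" .
qed

section \<open>The Poisson series\<close>

text \<open>With \<open>z = r e\<^sup>i\<^sup>x\<close> the terms with \<open>n \<ge> 0\<close> and with \<open>n < 0\<close> are geometric series in \<open>z\<close> and in
  its conjugate.\<close>

lemma poisson_has_sum_complex:
  fixes r x :: real
  assumes "0 \<le> r" "r < 1"
  shows "((\<lambda>n::int. of_real (r ^ nat \<bar>n\<bar>) * cis (of_int n * x)) has_sum of_real (poisson r x)) UNIV"
proof -
  define z where "z = of_real r * cis x"
  define F where "F = (\<lambda>n::int. of_real (r ^ nat \<bar>n\<bar>) * cis (of_int n * x))"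
  have nz: "norm z < 1" "norm (cnj z) < 1"
    using assms by (simp_all add: z_def norm_mult)
  have geo: "((\<lambda>n::nat. w ^ n) has_sum 1 / (1 - w)) UNIV" if "norm w < 1" for w :: complex
    using that by (intro norm_summable_imp_has_sum geometric_sums) (simp_all add: norm_power summable_geometric)
  have pos: "(F has_sum 1 / (1 - z)) (range int)"
  proof -
    have "F (int n) = z ^ n" for n
      by (simp add: F_def z_def power_mult_distrib Complex.DeMoivre)
    then have "F \<circ> int = (\<lambda>n. z ^ n)" by (simp add: fun_eq_iff)
    with geo [OF nz(1)] show ?thesis by (simp add: has_sum_reindex)
  qed
  have neg: "(F has_sum cnj z / (1 - cnj z)) (range (\<lambda>n. - int (Suc n)))"
  proof -
    have "F \<circ> (\<lambda>n. - int (Suc n)) = (\<lambda>n. cnj z * cnj z ^ n)"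
    proof
      fix n
      have cz: "cnj z = of_real r * cis (- x)" by (simp add: z_def cis_cnj)
      have "cnj z * cnj z ^ n = cnj z ^ Suc n" by simp
      also have "\<dots> = F (- int (Suc n))"
        unfolding F_def cz power_mult_distrib Complex.DeMoivre by (simp del: power_Suc of_nat_Suc)
      finally show "(F \<circ> (\<lambda>n. - int (Suc n))) n = cnj z * cnj z ^ n" by simp
    qed
    moreover have "((\<lambda>n. cnj z * cnj z ^ n) has_sum cnj z * (1 / (1 - cnj z))) UNIV"
      using geo [OF nz(2)] by (rule has_sum_cmult_right)
    moreover have "inj (\<lambda>n. - int (Suc n))" by (auto simp: inj_def)
    ultimately show ?thesis by (simp add: has_sum_reindex)
  qed
  have un: "range int \<union> range (\<lambda>n. - int (Suc n)) = UNIV"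
  proof -
    have "n \<in> range int \<union> range (\<lambda>n. - int (Suc n))" for n
      by (cases n) auto
    then show ?thesis by blast
  qed
  have "(F has_sum (1 / (1 - z) + cnj z / (1 - cnj z))) UNIV"
    using has_sum_Un_disjoint [OF pos neg] un by force
  moreover have "1 / (1 - z) + cnj z / (1 - cnj z) = of_real (poisson r x)"
  proof -
    have n: "1 - z \<noteq> 0" "1 - cnj z \<noteq> 0" using nz by auto
    have zz: "z * cnj z = of_real (r\<^sup>2)"
      by (simp add: z_def cis_cnj cis_mult power2_eq_square)
    have s: "z + cnj z = of_real (2 * r * cos x)"
      by (simp add: z_def complex_eq_iff)
    have d: "(1 - z) * (1 - cnj z) = of_real (1 - 2 * r * cos x + r\<^sup>2)"
      using zz s by (simp add: algebra_simps)
    have "1 / (1 - z) + cnj z / (1 - cnj z) = (1 - z * cnj z) / ((1 - z) * (1 - cnj z))"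
      using n by (simp add: field_simps)
    then show ?thesis unfolding d zz by (simp add: poisson_def)
  qed
  ultimately show ?thesis by (simp add: F_def)
qed

lemma poisson_has_sum:
  fixes r x :: real
  assumes "0 \<le> r" "r < 1"
  shows "((\<lambda>n::int. r ^ nat \<bar>n\<bar> * cos (of_int n * x)) has_sum poisson r x) UNIV"
    "((\<lambda>n::int. r ^ nat \<bar>n\<bar> * sin (of_int n * x)) has_sum 0) UNIV"
  using has_sum_Re [OF poisson_has_sum_complex [OF assms, of x]]
    has_sum_Im [OF poisson_has_sum_complex [OF assms, of x]]
  by simp_all

text \<open>Product-to-sum formulas reduce these to the Poisson series at \<open>t + s\<close> and \<open>t - s\<close>.\<close>

lemma poisson_product_has_sum:
  fixes r t s :: real
  assumes "0 \<le> r" "r < 1"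
  shows "((\<lambda>n::int. r ^ nat \<bar>n\<bar> * (cos (of_int n * t) * cos (of_int n * s))) has_sum kernel_even r t s) UNIV"
    and "((\<lambda>n::int. r ^ nat \<bar>n\<bar> * (sin (of_int n * t) * sin (of_int n * s))) has_sum - kernel_odd r t s) UNIV"
    and "((\<lambda>n::int. r ^ nat \<bar>n\<bar> * (cos (of_int n * t) * sin (of_int n * s))) has_sum 0) UNIV"
    and "((\<lambda>n::int. r ^ nat \<bar>n\<bar> * (sin (of_int n * t) * cos (of_int n * s))) has_sum 0) UNIV"
proof -
  note c = poisson_has_sum(1) [OF assms] and s = poisson_has_sum(2) [OF assms]
  have minus: "((\<lambda>n::int. - f n) has_sum - a) UNIV" if "(f has_sum a) UNIV" for f :: "int \<Rightarrow> real" and a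
    using that by (simp add: has_sum_uminus)
  have half: "((\<lambda>n::int. f n / 2) has_sum a / 2) UNIV" if "(f has_sum a) UNIV" for f :: "int \<Rightarrow> real" and a
    using has_sum_cmult_left [OF that, of "1/2"] by simp
  show "((\<lambda>n::int. r ^ nat \<bar>n\<bar> * (cos (of_int n * t) * cos (of_int n * s))) has_sum kernel_even r t s) UNIV"
    using half [OF has_sum_add [OF c [of "t + s"] c [of "t - s"]]]
    by (simp add: kernel_even_def cos_add cos_diff distrib_left right_diff_distrib mult.commute)
  show "((\<lambda>n::int. r ^ nat \<bar>n\<bar> * (sin (of_int n * t) * sin (of_int n * s))) has_sum - kernel_odd r t s) UNIV"
    using half [OF has_sum_add [OF c [of "t - s"] minus [OF c [of "t + s"]]]]
    by (simp add: kernel_odd_def cos_add cos_diff distrib_left right_diff_distrib minus_divide_left mult.commute)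
  show "((\<lambda>n::int. r ^ nat \<bar>n\<bar> * (cos (of_int n * t) * sin (of_int n * s))) has_sum 0) UNIV"
    using half [OF has_sum_add [OF s [of "t + s"] minus [OF s [of "t - s"]]]]
    by (simp add: sin_add sin_diff distrib_left right_diff_distrib)
  show "((\<lambda>n::int. r ^ nat \<bar>n\<bar> * (sin (of_int n * t) * cos (of_int n * s))) has_sum 0) UNIV"
    using half [OF has_sum_add [OF s [of "t + s"] s [of "t - s"]]]
    by (simp add: sin_add sin_diff distrib_left right_diff_distrib mult.commute)
qed

text \<open>Of the four products of sines and cosines the two mixed ones sum to zero.\<close>

lemma slice_series_has_sum:
  fixes r t s :: real and A B :: quat
  assumes r: "0 \<le> r" "r < 1"
  shows "((\<lambda>n::int. r ^ nat \<bar>n\<bar> *\<^sub>R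
      (qcis I (of_int n * t) * (cos (of_int n * s) *\<^sub>R A + sin (of_int n * s) *\<^sub>R B)))
    has_sum (kernel_even r t s *\<^sub>R A - kernel_odd r t s *\<^sub>R (I * B))) UNIV"
proof -
  have sc: "((\<lambda>n. f n *\<^sub>R q) has_sum a *\<^sub>R q) UNIV" if "(f has_sum a) UNIV" for f :: "int \<Rightarrow> real" and a and q :: quat
    using bounded_linear_scaleR_left that by (rule has_sum_bounded_linear)
  note p = poisson_product_has_sum [OF r, of t s]
  have "((\<lambda>n::int. (r ^ nat \<bar>n\<bar> * (cos (of_int n * t) * cos (of_int n * s))) *\<^sub>R A
      + (r ^ nat \<bar>n\<bar> * (cos (of_int n * t) * sin (of_int n * s))) *\<^sub>R B
      + (r ^ nat \<bar>n\<bar> * (sin (of_int n * t) * cos (of_int n * s))) *\<^sub>R (I * A)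
      + (r ^ nat \<bar>n\<bar> * (sin (of_int n * t) * sin (of_int n * s))) *\<^sub>R (I * B))
    has_sum (kernel_even r t s *\<^sub>R A + 0 *\<^sub>R B + 0 *\<^sub>R (I * A) + (- kernel_odd r t s) *\<^sub>R (I * B))) UNIV"
    by (intro has_sum_add sc p)
  then show ?thesis
    by (simp add: qcis_def of_real_def scaleR_add_right distrib_left distrib_right ac_simps)
qed

text \<open>The Poisson series at angle 0.\<close>

lemma summable_power_abs_int:
  fixes r :: real
  assumes "0 \<le> r" "r < 1"
  shows "(\<lambda>n::int. r ^ nat \<bar>n\<bar>) summable_on UNIV"
  using poisson_has_sum(1) [OF assms, of 0] by (auto simp: summable_on_def)

text \<open>Termwise integration of a dominated series, transferred from natural to integer indices by a
  bijection; absolute summability makes the order of summation immaterial.\<close>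

lemma has_sum_integral_int:
  fixes F :: "int \<Rightarrow> 'a \<Rightarrow> 'b::{banach, second_countable_topology}"
  assumes m: "\<And>n. F n \<in> borel_measurable M"
    and bound: "\<And>n x. norm (F n x) \<le> c n * g x" and g: "integrable M g"
    and c: "c summable_on UNIV"
    and sum: "\<And>x. ((\<lambda>n. F n x) has_sum S x) UNIV"
  shows "((\<lambda>n. LINT x|M. F n x) has_sum (LINT x|M. S x)) UNIV"
proof -
  have i: "integrable M (F n)" for n
  proof (rule Bochner_Integration.integrable_bound)
    show "integrable M (\<lambda>x. c n * g x)" using g by simp
    show "AE x in M. norm (F n x) \<le> norm (c n * g x)"
      using bound [of n] by (auto intro: order_trans [OF _ abs_ge_self])
  qed (rule m)
  have "(c \<circ> int_decode) summable_on UNIV"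
    using c surj_int_decode by (subst summable_on_reindex [symmetric]) (auto intro: inj_int_decode)
  then have c': "summable (\<lambda>k. c (int_decode k))"
    by (auto simp: o_def dest: summable_on_imp_summable)
  have ae: "AE x in M. summable (\<lambda>k. norm (F (int_decode k) x))"
    using bound by (intro AE_I2 summable_comparison_test' [OF summable_mult2 [OF c']]) auto
  have nb: "(LINT x|M. norm (F n x)) \<le> c n * (LINT x|M. g x)" for n
    using integral_mono [OF integrable_norm [OF i] integrable_mult_right [OF g]] bound [of n] by force
  have si: "summable (\<lambda>k. LINT x|M. norm (F (int_decode k) x))"
    using nb by (intro summable_comparison_test' [OF summable_mult2 [OF c']]) auto
  have "(\<lambda>k. LINT x|M. F (int_decode k) x) sums (LINT x|M. (\<Sum>k. F (int_decode k) x))"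
    using i ae si by (rule sums_integral)
  also have "(\<lambda>x. \<Sum>k. F (int_decode k) x) = S"
  proof
    fix x
    have "((\<lambda>k. F (int_decode k) x) has_sum S x) UNIV"
      using sum [of x] by (subst has_sum_reindex_bij_betw [OF bij_int_decode])
    then show "(\<Sum>k. F (int_decode k) x) = S x"
      by (metis has_sum_imp_sums sums_unique)
  qed
  finally have s: "(\<lambda>k. LINT x|M. F (int_decode k) x) sums (LINT x|M. S x)" .
  have "summable (\<lambda>k. norm (LINT x|M. F (int_decode k) x))"
    by (rule summable_comparison_test' [OF si]) (auto intro: integral_norm_bound)
  from norm_summable_imp_has_sum [OF this s] show ?thesis
    by (subst (asm) has_sum_reindex_bij_betw [OF bij_int_decode])
qed

section \<open>The coefficients of a slice function\<close>

lemma of_real_quat_measurable [measurable (raw)]: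
  "f \<in> borel_measurable M \<Longrightarrow> (\<lambda>x. of_real (f x) :: quat) \<in> borel_measurable M"
  unfolding of_real_def by (intro borel_measurable_scaleR borel_measurable_const)

text \<open>By periodicity the coefficient is a circle average of
  \<open>(cos (n s) - L * sin (n s)) * (a s + L * b s)\<close>. Symmetrizing in \<open>s\<close> removes
  the terms containing a single factor \<open>L\<close>, which explains the independence of \<open>L\<close>.\<close>

lemma slice_coeff_components:
  assumes f: "slice_function f" "integrable sphere_measure f" and L: "L \<in> imag_units"
  shows "slice_coeff L f n = (LINT s|circle_measure.
    cos (of_int n * s) *\<^sub>R slice_even f s + sin (of_int n * s) *\<^sub>R slice_odd f s)"
proof -
  define A B where "A = slice_even f" and "B = slice_odd f"
  have m: "f \<in> borel_measurable sphere_measure" using f(2) by auto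
  have [measurable]: "A \<in> borel_measurable borel" "B \<in> borel_measurable borel"
    unfolding A_def B_def by (rule slice_components_measurable [OF m])+
  have i: "integrable circle_measure A" "integrable circle_measure B"
    unfolding A_def B_def by (rule slice_components_integrable [OF f(2)])+
  define h where "h s = qcis L (- (of_int n * s)) * (A s + L * B s)" for s
  have hm [measurable]: "h \<in> borel_measurable borel"
    unfolding h_def [abs_def] qcis_def by measurable
  have per: "h (s + 2 * pi) = h s" for s
  proof -
    have "qcis L (- (of_int n * (s + 2 * pi))) = qcis L (- (of_int n * s) + 2 * of_int (- n) * pi)"
      by (simp add: algebra_simps)
    also have "\<dots> = qcis L (- (of_int n * s))"
      by (rule periodic_int_multiple) simp
    finally show ?thesis by (simp add: h_def A_def B_def)
  qed
  have ih: "integrable circle_measure h"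
  proof (rule Bochner_Integration.integrable_bound)
    show "integrable circle_measure (\<lambda>s. norm (A s) + norm (B s))" using i by simp
    show "AE s in circle_measure. norm (h s) \<le> norm (norm (A s) + norm (B s))"
    proof (rule AE_I2)
      fix s show "norm (h s) \<le> norm (norm (A s) + norm (B s))"
        using norm_triangle_ineq [of "A s" "L * B s"] L
        by (simp add: h_def norm_mult norm_qcis norm_imag_unit)
    qed
  qed simp
  have ih': "integrable circle_measure (\<lambda>s. h (- s))"
    using integrable_circle_reflect [OF hm per] ih by simp
  have "slice_coeff L f n = (1 / (2 * pi)) *\<^sub>R (LINT s:{-pi..pi}|lborel. h s)"
    unfolding slice_coeff_def h_def A_def B_def by (simp add: slice_function_components [OF f(1) L])
  also have "\<dots> = (LINT s|circle_measure. h s)"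
    by (rule circle_symmetric_interval [OF hm per ih])
  also have "\<dots> = (1/2) *\<^sub>R ((LINT s|circle_measure. h s) + (LINT s|circle_measure. h (- s)))"
    using integral_circle_reflect [OF hm per] by (simp add: half_scaleR_add_self)
  also have "\<dots> = (LINT s|circle_measure. (1/2) *\<^sub>R (h s + h (- s)))"
    using ih ih' by simp
  also have "\<dots> = (LINT s|circle_measure. cos (of_int n * s) *\<^sub>R A s + sin (of_int n * s) *\<^sub>R B s)"
  proof (rule Bochner_Integration.integral_cong [OF refl])
    fix s
    have "h s + h (- s) = (cos (of_int n * s) *\<^sub>R A s + sin (of_int n * s) *\<^sub>R B s)
        + (cos (of_int n * s) *\<^sub>R A s + sin (of_int n * s) *\<^sub>R B s)"
      by (simp add: h_def A_def B_def qcis_def of_real_def algebra_simps imag_unit_square_left [OF L])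
    then show "(1/2) *\<^sub>R (h s + h (- s)) = cos (of_int n * s) *\<^sub>R A s + sin (of_int n * s) *\<^sub>R B s"
      by (simp only: half_scaleR_add_self)
  qed
  finally show ?thesis by (simp add: A_def B_def)
qed

text \<open>The theorem for a slice function in place of \<open>\<phi>\<close>: both sides are circle averages in the
  components of \<open>f\<close>, and the integrands agree by the Poisson series.\<close>

lemma slice_extension_series:
  assumes r: "0 \<le> r" "r < 1" and I: "I \<in> imag_units" and L: "L \<in> imag_units" and f: "f \<in> L2_slice"
  shows "((\<lambda>n::int. r ^ nat \<bar>n\<bar> *\<^sub>R (qcis I (of_int n * t) * slice_coeff L f n))
    has_sum (LINT q|sphere_measure. slice_kernel (r *\<^sub>R qcis I t) q * f q)) UNIV"
proof -
  have f2: "f \<in> L2" "slice_function f" using f by (simp_all add: L2_slice_def)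
  define A B where "A = slice_even f" and "B = slice_odd f"
  have AB [measurable]: "A \<in> borel_measurable borel" "B \<in> borel_measurable borel"
    unfolding A_def B_def by (rule slice_components_measurable [OF L2_measurable [OF f2(1)]])+
  have i: "integrable circle_measure A" "integrable circle_measure B"
    unfolding A_def B_def by (rule slice_components_integrable [OF L2_integrable [OF f2(1)]])+
  define G where "G n s = cos (of_int n * s) *\<^sub>R A s + sin (of_int n * s) *\<^sub>R B s" for n :: int and s
  define F where "F n s = r ^ nat \<bar>n\<bar> *\<^sub>R (qcis I (of_int n * t) * G n s)" for n :: int and s
  have G [measurable]: "G n \<in> borel_measurable borel" for n
    unfolding G_def [abs_def] by measurable
  have Gb: "norm (G n s) \<le> norm (A s) + norm (B s)" for n s
  proof -
    have "norm (G n s) \<le> \<bar>cos (of_int n * s)\<bar> * norm (A s) + \<bar>sin (of_int n * s)\<bar> * norm (B s)"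
      unfolding G_def by (metis norm_scaleR norm_triangle_ineq)
    also have "\<dots> \<le> 1 * norm (A s) + 1 * norm (B s)"
      by (intro add_mono mult_right_mono) auto
    finally show ?thesis by simp
  qed
  have Gi: "integrable circle_measure (G n)" for n
    by (rule Bochner_Integration.integrable_bound [of _ "\<lambda>s. norm (A s) + norm (B s)"])
      (use i Gb in auto)
  have "((\<lambda>n. LINT s|circle_measure. F n s) has_sum
      (LINT s|circle_measure. kernel_even r t s *\<^sub>R A s - kernel_odd r t s *\<^sub>R (I * B s))) UNIV"
  proof (rule has_sum_integral_int)
    show "F n \<in> borel_measurable circle_measure" for n
      unfolding F_def [abs_def] by simp
    show "norm (F n s) \<le> r ^ nat \<bar>n\<bar> * (norm (A s) + norm (B s))" for n s
      using Gb [of n s] r I by (simp add: F_def norm_mult norm_qcis mult_left_mono)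
    show "integrable circle_measure (\<lambda>s. norm (A s) + norm (B s))" using i by simp
    show "(\<lambda>n::int. r ^ nat \<bar>n\<bar>) summable_on UNIV" by (rule summable_power_abs_int [OF r])
    show "((\<lambda>n. F n s) has_sum (kernel_even r t s *\<^sub>R A s - kernel_odd r t s *\<^sub>R (I * B s))) UNIV" for s
      unfolding F_def G_def by (rule slice_series_has_sum [OF r])
  qed
  moreover have "(LINT s|circle_measure. F n s) = r ^ nat \<bar>n\<bar> *\<^sub>R (qcis I (of_int n * t) * slice_coeff L f n)" for n
  proof -
    have "slice_coeff L f n = (LINT s|circle_measure. G n s)"
      unfolding G_def A_def B_def by (rule slice_coeff_components [OF f2(2) L2_integrable [OF f2(1)] L])
    then show ?thesis using Gi [of n] by (simp add: F_def)
  qed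
  moreover have "(LINT q|sphere_measure. slice_kernel (r *\<^sub>R qcis I t) q * f q)
      = (LINT s|circle_measure. kernel_even r t s *\<^sub>R A s - kernel_odd r t s *\<^sub>R (I * B s))"
  proof -
    note k = kernel_component_slices [OF r, of t]
    have g: "even_kernel_slice r t \<in> L2" "slice_function (even_kernel_slice r t)"
      "odd_kernel_slice r t \<in> L2" "slice_function (odd_kernel_slice r t)"
      using k by (simp_all add: L2_slice_def)
    have e: "L2_inner f (even_kernel_slice r t) = (LINT s|circle_measure. kernel_even r t s *\<^sub>R A s)"
      using g f2(1) k by (simp add: L2_inner_components L2_measurable L2_integrable L2_product_integrable
          A_def scaleR_conv_of_real)
    have o: "L2_inner f (odd_kernel_slice r t) = (LINT s|circle_measure. kernel_odd r t s *\<^sub>R B s)"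
      using g f2(1) k by (simp add: L2_inner_components L2_measurable L2_integrable L2_product_integrable
          B_def scaleR_conv_of_real)
    obtain C where C: "\<And>s. \<bar>kernel_even r t s\<bar> \<le> C" "\<And>s. \<bar>kernel_odd r t s\<bar> \<le> C"
      using kernel_bounded [OF r] by blast
    then have C: "\<bar>kernel_even r t s\<bar> \<le> \<bar>C\<bar>" "\<bar>kernel_odd r t s\<bar> \<le> \<bar>C\<bar>" for s
      by (meson abs_ge_self order_trans)+
    have ie: "integrable circle_measure (\<lambda>s. kernel_even r t s *\<^sub>R A s)"
      by (rule Bochner_Integration.integrable_bound [of _ "\<lambda>s. C *\<^sub>R A s"])
        (use i C in \<open>auto intro!: mult_right_mono\<close>)
    have io: "integrable circle_measure (\<lambda>s. kernel_odd r t s *\<^sub>R B s)"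
      by (rule Bochner_Integration.integrable_bound [of _ "\<lambda>s. C *\<^sub>R B s"])
        (use i C in \<open>auto intro!: mult_right_mono\<close>)
    have "(LINT s|circle_measure. kernel_even r t s *\<^sub>R A s - kernel_odd r t s *\<^sub>R (I * B s))
        = (LINT s|circle_measure. kernel_even r t s *\<^sub>R A s - I * (kernel_odd r t s *\<^sub>R B s))"
      by simp
    also have "\<dots> = L2_inner f (even_kernel_slice r t) - I * L2_inner f (odd_kernel_slice r t)"
      unfolding e o using ie io by (simp del: mult_scaleR_right)
    finally show ?thesis using slice_kernel_integral(2) [OF r I f2(1), of t] by simp
  qed
  ultimately show ?thesis by simp
qed

theorem lemma3:
  fixes \<phi> :: "quat \<Rightarrow> quat"
  assumes "\<phi> \<in> L2"
  shows "(\<exists>f. is_slice_projection \<phi> f) \<and>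
    (\<forall>f. is_slice_projection \<phi> f \<longrightarrow>
      (\<forall>r I t. 0 \<le> r \<and> r < 1 \<and> I \<in> imag_units \<longrightarrow>
        integrable sphere_measure (\<lambda>q. slice_kernel (r *\<^sub>R qcis I t) q * \<phi> q) \<and>
        has_slice_extension f (r *\<^sub>R qcis I t)
          (LINT q|sphere_measure. slice_kernel (r *\<^sub>R qcis I t) q * \<phi> q)))"
proof (intro conjI allI impI)
  show "\<exists>f. is_slice_projection \<phi> f"
    using slice_projection_exists [OF assms] by blast
next
  fix f and r t :: real and I assume "is_slice_projection \<phi> f" and rI: "0 \<le> r \<and> r < 1 \<and> I \<in> imag_units"
  then have f: "f \<in> L2_slice" "f \<in> L2"
    and orth: "\<And>g. g \<in> L2_slice \<Longrightarrow> L2_inner (\<lambda>q. \<phi> q - f q) g = 0"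
    by (auto simp: is_slice_projection_def L2_slice_def)
  show "integrable sphere_measure (\<lambda>q. slice_kernel (r *\<^sub>R qcis I t) q * \<phi> q)"
    using rI slice_kernel_integral(1) [of r I \<phi> t] assms by simp
  \<comment> \<open>The kernel integral is built from inner products with slice functions, and orthogonality
    makes these agree for \<open>\<phi>\<close> and \<open>f\<close>.\<close>
  have same: "L2_inner \<phi> g = L2_inner f g" if "g \<in> L2_slice" for g
    using orth [OF that] L2_inner_diff [OF assms f(2), of g] that by (simp add: L2_slice_def)
  show "has_slice_extension f (r *\<^sub>R qcis I t)
      (LINT q|sphere_measure. slice_kernel (r *\<^sub>R qcis I t) q * \<phi> q)"
    unfolding has_slice_extension_def
  \<comment> \<open>The integral depends on the point only, so any polar representation of it may be used.\<close>
  proof (intro allI ballI impI)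
    fix r' t' :: real and I' L
    assume L: "L \<in> imag_units"
      and *: "0 \<le> r' \<and> r' < 1 \<and> I' \<in> imag_units \<and> r *\<^sub>R qcis I t = r' *\<^sub>R qcis I' t'"
    then have r': "0 \<le> r'" "r' < 1" and I': "I' \<in> imag_units" and p: "r *\<^sub>R qcis I t = r' *\<^sub>R qcis I' t'"
      by simp_all
    have "(LINT q|sphere_measure. slice_kernel (r *\<^sub>R qcis I t) q * \<phi> q)
        = (LINT q|sphere_measure. slice_kernel (r' *\<^sub>R qcis I' t') q * f q)"
      unfolding p slice_kernel_integral(2) [OF r' I' assms] slice_kernel_integral(2) [OF r' I' f(2)]
      by (simp add: same kernel_component_slices [OF r'])
    with slice_extension_series [OF r' I' L f(1), of t']
    show "((\<lambda>n::int. r' ^ nat \<bar>n\<bar> *\<^sub>R (qcis I' (of_int n * t') * slice_coeff L f n)) has_sum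
        (LINT q|sphere_measure. slice_kernel (r *\<^sub>R qcis I t) q * \<phi> q)) UNIV"
      by simp
  qed
qed

end
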